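(* Let $q\in\Bbbk$ with $q\ne0$, and let $H$ be a connected $q$-Hopf algebra over $\Bbbk$, with finite-dimensional homogeneous components $H_m$, that is cofree as a graded coalgebra. Let $S$ be its antipode, $V=\mathcal P(H)$ its space of primitive elements, $v_n=\dim V_n$, and $$v_q(t)=\sum_{n\ge1}v_n\frac{t^n}{q^{\binom n2}}.$$ Then, as formal power series in $t$, $$\sum_{m\ge0}\operatorname{trace}\bigl(S|_{H_m}\bigr)\frac{t^m}{q^{\binom m2}}=\frac{1-v_q(t)}{1-v_{q^2}(t^2)}.$$
   Context: $\Bbbk$ is a field of characteristic zero. A $q$-Hopf algebra is a Hopf monoid in the lax braided monoidal category of graded vector spaces with lax braiding $x\otimes y\mapsto q^{mn}\,y\otimes x$ for $x,y$ homogeneous of degrees $m,n$. Concretely: a graded vector space $H=\bigoplus_{m\ge0}H_m$ that is a graded algebra and a graded coalgebra, such that the counit is an algebra map, $\Delta(1)=1\otimes1$, and $\Delta:H\to H\otimes H$ is an algebra map when $H\otimes H$ has the product $(x\otimes y)(x'\otimes y')=q^{|y||x'|}\,xx'\otimes yy'$ on homogeneous elements, and having an antipode $S$ (the inverse of the identity under convolution $P\ast Q=\mu\circ(P\otimes Q)\circ\Delta$), which preserves degree. It is connected if $\dim H_0=1$ (the antipode then exists automatically). $H$ is cofree as a graded coalgebra if it is isomorphic, as a graded coalgebra, to the deconcatenation coalgebra $\bigoplus_{k\ge0}V^{\otimes k}$ on a graded vector space $V$, with coproduct $\Delta(x_1\cdots x_k)=1\otimes(x_1\cdots x_k)+\sum_{i=1}^{k-1}(x_1\cdots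 x_i)\otimes(x_{i+1}\cdots x_k)+(x_1\cdots x_k)\otimes1$; then $V\cong\mathcal P(H)=\{x\in H:\Delta(x)=1\otimes x+x\otimes1\}$. Here $v_{q^2}(t^2)=\sum_{n\ge1}v_n\,t^{2n}/q^{2\binom n2}$. *)

theory Defs
  imports
    "HOL-Library.Poly_Mapping"
    "HOL-Computational_Algebra.Formal_Power_Series"
begin

text \<open>
  Tensor powers are presented as usual by generators and relations. The free vector space on the
  words over a vector space is the type of finitely supported functions on lists; the word
  \<open>[x1, ..., xk]\<close> stands for \<open>x1 \<otimes> ... \<otimes> xk\<close>. Two formal sums denote the same tensor iff they differ by
  an element of the subspace spanned by the multilinearity relations. As these relations preserve
  the length of words, the quotient of the formal sums on words of length \<open>k\<close> is the \<open>k\<close>-th tensor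
  power, and the quotient of all formal sums is the direct sum of all tensor powers.

  The scalar multiplication is a parameter, so this quotient is not a type. Instead, maps into
  a tensor power take values in formal sums, and equations between tensors are stated with the
  congruence \<open>tensor_eq\<close>.
\<close>

definition formal_scale :: "'k::field \<Rightarrow> ('x \<Rightarrow>\<^sub>0 'k) \<Rightarrow> ('x \<Rightarrow>\<^sub>0 'k)" where
  "formal_scale c p = Poly_Mapping.map ((*) c) p"

lemma lookup_formal_scale [simp]:
  "Poly_Mapping.lookup (formal_scale c p) x = c * Poly_Mapping.lookup p x"
  by (simp add: formal_scale_def Poly_Mapping.map.rep_eq when_def)

lemma vector_space_formal_scale: "vector_space formal_scale"
  by unfold_locales (auto intro!: poly_mapping_eqI simp: lookup_add algebra_simps)

definition lin_extend ::
  "('k::field \<Rightarrow> 'b::ab_group_add \<Rightarrow> 'b) \<Rightarrow> ('x \<Rightarrow> 'b) \<Rightarrow> ('x \<Rightarrow>\<^sub>0 'k) \<Rightarrow> 'b" where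
  "lin_extend scale f p = (\<Sum>x\<in>Poly_Mapping.keys p. scale (Poly_Mapping.lookup p x) (f x))"

definition tensor_relations ::
  "('k::field \<Rightarrow> 'a::ab_group_add \<Rightarrow> 'a) \<Rightarrow> ('a list \<Rightarrow>\<^sub>0 'k) set" where
  "tensor_relations scale =
     {Poly_Mapping.single (u @ [x + y] @ w) 1
        - Poly_Mapping.single (u @ [x] @ w) 1 - Poly_Mapping.single (u @ [y] @ w) 1 | u w x y. True}
   \<union> {Poly_Mapping.single (u @ [scale c x] @ w) 1
        - formal_scale c (Poly_Mapping.single (u @ [x] @ w) 1) | u w c x. True}"

definition tensor_eq ::
  "('k::field \<Rightarrow> 'a::ab_group_add \<Rightarrow> 'a) \<Rightarrow> ('a list \<Rightarrow>\<^sub>0 'k) \<Rightarrow> ('a list \<Rightarrow>\<^sub>0 'k) \<Rightarrow> bool" where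
  "tensor_eq scale p p' \<longleftrightarrow> p - p' \<in> module.span formal_scale (tensor_relations scale)"

definition tensor_append ::
  "('a list \<Rightarrow>\<^sub>0 'k::field) \<Rightarrow> ('a list \<Rightarrow>\<^sub>0 'k) \<Rightarrow> ('a list \<Rightarrow>\<^sub>0 'k)" where
  "tensor_append p p' =
     lin_extend formal_scale
       (\<lambda>u. lin_extend formal_scale (\<lambda>w. Poly_Mapping.single (u @ w) 1) p') p"

definition tensor_map :: "('a \<Rightarrow> 'b) \<Rightarrow> ('a list \<Rightarrow>\<^sub>0 'k::field) \<Rightarrow> ('b list \<Rightarrow>\<^sub>0 'k)" where
  "tensor_map f p = lin_extend formal_scale (\<lambda>w. Poly_Mapping.single (map f w) 1) p"

definition homogeneous_decomposition ::
  "(nat \<Rightarrow> 'a::ab_group_add set) \<Rightarrow> 'a \<Rightarrow> (nat \<Rightarrow> 'a) \<Rightarrow> bool" where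
  "homogeneous_decomposition H x f \<longleftrightarrow>
     (\<forall>m. f m \<in> H m) \<and> finite {m. f m \<noteq> 0} \<and> x = (\<Sum>m | f m \<noteq> 0. f m)"

definition component :: "(nat \<Rightarrow> 'a::ab_group_add set) \<Rightarrow> 'a \<Rightarrow> nat \<Rightarrow> 'a" where
  "component H x = (THE f. homogeneous_decomposition H x f)"

locale graded_vector_space = vector_space scale
  for scale :: "'k::field \<Rightarrow> 'a::ab_group_add \<Rightarrow> 'a" +
  fixes H :: "nat \<Rightarrow> 'a set"
  assumes subspace_degree: "subspace (H m)"
    and direct_sum: "\<exists>!f. homogeneous_decomposition H x f"

definition finite_dimensional ::
  "('k::field \<Rightarrow> 'a::ab_group_add \<Rightarrow> 'a) \<Rightarrow> 'a set \<Rightarrow> bool" where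
  "finite_dimensional scale U \<longleftrightarrow> (\<exists>B. finite B \<and> U = module.span scale B)"

text \<open>If \<open>U\<close> is finite-dimensional and stable under \<open>f\<close>, the value below does not depend on the
  chosen basis.\<close>

definition trace_on ::
  "('k::field \<Rightarrow> 'a::ab_group_add \<Rightarrow> 'a) \<Rightarrow> 'a set \<Rightarrow> ('a \<Rightarrow> 'a) \<Rightarrow> 'k" where
  "trace_on scale U f =
     (let B = (SOME B. \<not> module.dependent scale B \<and> module.span scale B = U)
      in \<Sum>b\<in>B. module.representation scale B (f b) b)"

locale graded_coalgebra = graded_vector_space scale H
  for scale :: "'k::field \<Rightarrow> 'a::ab_group_add \<Rightarrow> 'a" and H :: "nat \<Rightarrow> 'a set" +
  fixes \<Delta> :: "'a \<Rightarrow> ('a list \<Rightarrow>\<^sub>0 'k)"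
    and \<epsilon> :: "'a \<Rightarrow> 'k"
  assumes comult_keys: "Poly_Mapping.keys (\<Delta> x) \<subseteq> {w. length w = 2}"
    and comult_add: "tensor_eq scale (\<Delta> (x + y)) (\<Delta> x + \<Delta> y)"
    and comult_scale: "tensor_eq scale (\<Delta> (scale c x)) (formal_scale c (\<Delta> x))"
    and comult_degree: "x \<in> H m \<Longrightarrow>
      \<exists>p. tensor_eq scale (\<Delta> x) p \<and>
          Poly_Mapping.keys p \<subseteq> {[a, b] | a b i j. a \<in> H i \<and> b \<in> H j \<and> i + j = m}"
    and counit_linear: "Vector_Spaces.linear scale (*) \<epsilon>"
    and counit_degree: "x \<in> H m \<Longrightarrow> m > 0 \<Longrightarrow> \<epsilon> x = 0"
    and coassoc: "tensor_eq scale
      (lin_extend formal_scale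
        (\<lambda>w. tensor_append (\<Delta> (w ! 0)) (Poly_Mapping.single [w ! 1] 1)) (\<Delta> x))
      (lin_extend formal_scale
        (\<lambda>w. tensor_append (Poly_Mapping.single [w ! 0] 1) (\<Delta> (w ! 1))) (\<Delta> x))"
    and counit_left: "lin_extend scale (\<lambda>w. scale (\<epsilon> (w ! 0)) (w ! 1)) (\<Delta> x) = x"
    and counit_right: "lin_extend scale (\<lambda>w. scale (\<epsilon> (w ! 1)) (w ! 0)) (\<Delta> x) = x"

text \<open>
  The deconcatenation coalgebra on a graded vector space \<open>W\<close> is the direct sum of all tensor powers
  of \<open>W\<close>: its elements are represented by formal sums of words over \<open>W\<close>, and elements of its
  tensor square by formal sums of words of length two whose letters are such formal sums. The word
  \<open>[x1, ..., xk]\<close> with \<open>xi\<close> of degree \<open>ni\<close> has degree \<open>n1 + ... + nk\<close>, and the counit is the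
  coefficient of the empty word.
\<close>

definition deconcatenation ::
  "('w list \<Rightarrow>\<^sub>0 'k::field) \<Rightarrow> (('w list \<Rightarrow>\<^sub>0 'k) list \<Rightarrow>\<^sub>0 'k)" where
  "deconcatenation p =
     lin_extend formal_scale
       (\<lambda>w. \<Sum>i\<le>length w. Poly_Mapping.single
              [Poly_Mapping.single (take i w) 1, Poly_Mapping.single (drop i w) 1] 1) p"

text \<open>In the next definition \<open>\<Psi>\<close> is a linear map on formal sums; the second conjunct says that it
  descends to an injective map on tensors.\<close>

definition deconcatenation_isomorphism ::
  "('k::field \<Rightarrow> 'w::ab_group_add \<Rightarrow> 'w) \<Rightarrow> (nat \<Rightarrow> 'w set) \<Rightarrow>
   ('k \<Rightarrow> 'a::ab_group_add \<Rightarrow> 'a) \<Rightarrow> (nat \<Rightarrow> 'a set) \<Rightarrow>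
   ('a \<Rightarrow> ('a list \<Rightarrow>\<^sub>0 'k)) \<Rightarrow> ('a \<Rightarrow> 'k) \<Rightarrow> (('w list \<Rightarrow>\<^sub>0 'k) \<Rightarrow> 'a) \<Rightarrow> bool" where
  "deconcatenation_isomorphism scaleW W scale H \<Delta> \<epsilon> \<Psi> \<longleftrightarrow>
     Vector_Spaces.linear formal_scale scale \<Psi> \<and>
     (\<forall>p p'. \<Psi> p = \<Psi> p' \<longleftrightarrow> tensor_eq scaleW p p') \<and>
     surj \<Psi> \<and>
     (\<forall>w ns. list_all2 (\<lambda>x n. x \<in> W n) w ns \<longrightarrow> \<Psi> (Poly_Mapping.single w 1) \<in> H (sum_list ns)) \<and>
     (\<forall>p. tensor_eq scale (\<Delta> (\<Psi> p)) (tensor_map \<Psi> (deconcatenation p))) \<and>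
     (\<forall>p. \<epsilon> (\<Psi> p) = Poly_Mapping.lookup p [])"

definition cofree_on ::
  "('k::field \<Rightarrow> 'w::ab_group_add \<Rightarrow> 'w) \<Rightarrow> (nat \<Rightarrow> 'w set) \<Rightarrow>
   ('k \<Rightarrow> 'a::ab_group_add \<Rightarrow> 'a) \<Rightarrow> (nat \<Rightarrow> 'a set) \<Rightarrow>
   ('a \<Rightarrow> ('a list \<Rightarrow>\<^sub>0 'k)) \<Rightarrow> ('a \<Rightarrow> 'k) \<Rightarrow> bool" where
  "cofree_on scaleW W scale H \<Delta> \<epsilon> \<longleftrightarrow>
     graded_vector_space scaleW W \<and>
     (\<exists>\<Psi>. deconcatenation_isomorphism scaleW W scale H \<Delta> \<epsilon> \<Psi>)"

text \<open>The product \<open>(x \<otimes> y) (x' \<otimes> y') = q^(|y| |x'|) x x' \<otimes> y y'\<close> of homogeneous tensors, extended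
  bilinearly by splitting \<open>y\<close> and \<open>x'\<close> into their homogeneous components.\<close>

definition twisted_mult ::
  "'k::field \<Rightarrow> (nat \<Rightarrow> 'a::ring_1 set) \<Rightarrow> ('a list \<Rightarrow>\<^sub>0 'k) \<Rightarrow> ('a list \<Rightarrow>\<^sub>0 'k) \<Rightarrow> ('a list \<Rightarrow>\<^sub>0 'k)" where
  "twisted_mult q H p p' =
     lin_extend formal_scale (\<lambda>u. lin_extend formal_scale (\<lambda>w.
       \<Sum>i | component H (u ! 1) i \<noteq> 0. \<Sum>j | component H (w ! 0) j \<noteq> 0.
         Poly_Mapping.single
           [u ! 0 * component H (w ! 0) j, component H (u ! 1) i * w ! 1] (q ^ (i * j))) p') p"

definition convolution ::
  "('k::field \<Rightarrow> 'a::ring_1 \<Rightarrow> 'a) \<Rightarrow> ('a \<Rightarrow> ('a list \<Rightarrow>\<^sub>0 'k)) \<Rightarrow> ('a \<Rightarrow> 'a) \<Rightarrow> ('a \<Rightarrow> 'a) \<Rightarrow> 'a \<Rightarrow> 'a" where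
  "convolution scale \<Delta> P Q x = lin_extend scale (\<lambda>w. P (w ! 0) * Q (w ! 1)) (\<Delta> x)"

locale q_hopf_algebra = graded_coalgebra scale H \<Delta> \<epsilon>
  for scale :: "'k::field \<Rightarrow> 'a::ring_1 \<Rightarrow> 'a" and H :: "nat \<Rightarrow> 'a set"
    and \<Delta> :: "'a \<Rightarrow> ('a list \<Rightarrow>\<^sub>0 'k)" and \<epsilon> :: "'a \<Rightarrow> 'k" +
  fixes q :: 'k
    and S :: "'a \<Rightarrow> 'a"
  assumes scale_mult_left: "scale c x * y = scale c (x * y)"
    and scale_mult_right: "x * scale c y = scale c (x * y)"
    and one_degree: "1 \<in> H 0"
    and mult_degree: "x \<in> H m \<Longrightarrow> y \<in> H n \<Longrightarrow> x * y \<in> H (m + n)"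
    and counit_one: "\<epsilon> 1 = 1"
    and counit_mult: "\<epsilon> (x * y) = \<epsilon> x * \<epsilon> y"
    and comult_one: "tensor_eq scale (\<Delta> 1) (Poly_Mapping.single [1, 1] 1)"
    and comult_mult: "tensor_eq scale (\<Delta> (x * y)) (twisted_mult q H (\<Delta> x) (\<Delta> y))"
    and antipode_linear: "Vector_Spaces.linear scale scale S"
    and antipode_degree: "x \<in> H m \<Longrightarrow> S x \<in> H m"
    and antipode_left: "convolution scale \<Delta> S id x = scale (\<epsilon> x) 1"
    and antipode_right: "convolution scale \<Delta> id S x = scale (\<epsilon> x) 1"

definition primitives ::
  "('k::field \<Rightarrow> 'a::ring_1 \<Rightarrow> 'a) \<Rightarrow> ('a \<Rightarrow> ('a list \<Rightarrow>\<^sub>0 'k)) \<Rightarrow> 'a set" where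
  "primitives scale \<Delta> =
     {x. tensor_eq scale (\<Delta> x) (Poly_Mapping.single [1, x] 1 + Poly_Mapping.single [x, 1] 1)}"

definition dim_series :: "(nat \<Rightarrow> nat) \<Rightarrow> 'k::field \<Rightarrow> 'k fps" where
  "dim_series v q = Abs_fps (\<lambda>n. if n = 0 then 0 else of_nat (v n) / q ^ (n choose 2))"

end

theory Submission
  imports Defs "HOL-Computational_Algebra.Formal_Laurent_Series"
begin

text \<open>
  Choose a basis \<open>B\<close> of \<open>W\<close> consisting of homogeneous elements, its letters. The words over \<open>B\<close> give
  a homogeneous basis of \<open>H\<close> on which the coproduct is deconcatenation. The trace of \<open>S\<close> on \<open>H m\<close> is
  the sum of the diagonal entries of its matrix in this basis, so it is determined by the terms of
  \<open>S w\<close> that are not shorter than \<open>w\<close>, and these can be computed.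

  The coefficient of \<open>w1 w2\<close> in \<open>x\<close> is the coefficient of \<open>w1 \<otimes> w2\<close> in \<open>\<Delta> x\<close>. As \<open>\<Delta>\<close> is
  multiplicative for the twisted product, the coefficient of \<open>w1 w2\<close> in \<open>u v\<close> is the sum, over all
  cuts \<open>u = u' u''\<close> and \<open>v = v' v''\<close>, of \<open>q\<close> to the power \<open>|u''| |v'|\<close> times the coefficients of \<open>w1\<close> in
  \<open>u' v'\<close> and of \<open>w2\<close> in \<open>u'' v''\<close> (\<open>mult_coefficient_append\<close>). Splitting off the first letter of
  the result shows that \<open>u v\<close> has no term longer than \<open>u\<close> and \<open>v\<close> together, and that its terms of
  maximal length obey the recursion of the q-shuffle product (\<open>mult_coefficient_shuffle\<close>).
  So \<open>H\<close> is a q-shuffle algebra up to shorter words, although its product can be complicated.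

  In a q-shuffle algebra the antipode reverses a word \<open>x1 ... xk\<close> and multiplies it by the sign
  \<open>(-1)^k\<close> and by \<open>q\<close> to the power \<open>\<Sum>i<j. |xi| |xj|\<close>: the convolution equation of \<open>S\<close> and the
  identity telescopes with these values (\<open>alternating_shuffle_sum\<close>). By induction on the length, the
  antipode of \<open>H\<close> has the same value up to shorter words (\<open>antipode_coefficient\<close>).

  So only palindromes contribute to the trace. The exponent \<open>m choose 2\<close> is the sum of the exponents
  \<open>|xi| choose 2\<close> and of the products \<open>|xi| |xj|\<close>, so after division by \<open>q ^ (m choose 2)\<close> a palindrome
  has the multiplicative weight \<open>(-1)^k\<close> times the product of the \<open>1 / q ^ (|xi| choose 2)\<close>. A palindrome
  is empty, a letter, or \<open>b p b\<close> with a shorter palindrome \<open>p\<close>. Hence the series \<open>F\<close> of the weights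
  satisfies \<open>F = 1 - N + D F\<close>, where \<open>N\<close> is the weighted series of the letters and \<open>D\<close> that of the
  pairs of equal letters. The number of
  letters of degree \<open>n\<close> is \<open>v n\<close>, because the letters form a basis of the primitive elements
  (\<open>dim_primitives\<close>).
\<close>

section \<open>Linear maps on formal sums of words\<close>

abbreviation "word w \<equiv> Poly_Mapping.single w 1"

interpretation formal: vector_space formal_scale
  by (rule vector_space_formal_scale)

interpretation field: vector_space "(*) :: 'k::field \<Rightarrow> 'k \<Rightarrow> 'k"
  by unfold_locales (simp_all add: algebra_simps)

lemmas linear_sum = module_hom.sum[OF Vector_Spaces.linear.axioms(3)]
  and linear_zero = module_hom.zero[OF Vector_Spaces.linear.axioms(3)]

lemma linear_addD: "Vector_Spaces.linear s s' f \<Longrightarrow> f (x + y) = f x + f y"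
  and linear_scaleD: "Vector_Spaces.linear s s' f \<Longrightarrow> f (s c x) = s' c (f x)"
  by (simp_all add: Vector_Spaces.linear_iff)

lemma linear_eq_on_spanning:
  assumes "Vector_Spaces.linear s s' f" "Vector_Spaces.linear s s' g"
    and "\<And>b. b \<in> B \<Longrightarrow> f b = g b" and "x \<in> module.span s B"
  shows "f x = g x"
  by (rule vector_space_pair.linear_eq_on_span[OF _ assms])
     (use assms(1) in \<open>auto simp: Vector_Spaces.linear_iff vector_space_pair_def\<close>)

lemma linear_functional_mult:
  assumes "Vector_Spaces.linear s (*) f"
  shows "Vector_Spaces.linear s (*) (\<lambda>x. c * f x)" "Vector_Spaces.linear s (*) (\<lambda>x. f x * c)"
proof -
  have "vector_space s"
    using Vector_Spaces.linear.axioms(1)[OF assms] .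
  then show "Vector_Spaces.linear s (*) (\<lambda>x. c * f x)" "Vector_Spaces.linear s (*) (\<lambda>x. f x * c)"
    unfolding Vector_Spaces.linear_iff linear_addD[OF assms] linear_scaleD[OF assms]
    by (simp_all add: field.vector_space_axioms distrib_left distrib_right)
qed

lemma (in vector_space) linear_functional_zero: "Vector_Spaces.linear scale (*) (\<lambda>x. 0)"
  by (simp add: Vector_Spaces.linear_iff vector_space_axioms field.vector_space_axioms)

lemma (in vector_space) linear_functional_sum:
  assumes "\<And>i. i \<in> A \<Longrightarrow> Vector_Spaces.linear scale (*) (f i)"
  shows "Vector_Spaces.linear scale (*) (\<lambda>x. \<Sum>i\<in>A. f i x)"
  unfolding Vector_Spaces.linear_iff
  using linear_addD[OF assms] linear_scaleD[OF assms]
  by (simp add: vector_space_axioms field.vector_space_axioms sum.distrib sum_distrib_left)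

definition bilinear_map ::
  "('k::field \<Rightarrow> 'a::ab_group_add \<Rightarrow> 'a) \<Rightarrow> ('k \<Rightarrow> 'b::ab_group_add \<Rightarrow> 'b) \<Rightarrow> ('a \<Rightarrow> 'a \<Rightarrow> 'b) \<Rightarrow> bool" where
  "bilinear_map s s' G \<longleftrightarrow>
     (\<forall>y. Vector_Spaces.linear s s' (\<lambda>x. G x y)) \<and> (\<forall>x. Vector_Spaces.linear s s' (G x))"

definition multilinear_on_words ::
  "('k::field \<Rightarrow> 'a::ab_group_add \<Rightarrow> 'a) \<Rightarrow> ('k \<Rightarrow> 'b::ab_group_add \<Rightarrow> 'b) \<Rightarrow> ('a list \<Rightarrow> 'b) \<Rightarrow> bool" where
  "multilinear_on_words s s' F \<longleftrightarrow> (\<forall>u w. Vector_Spaces.linear s s' (\<lambda>x. F (u @ [x] @ w)))"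

text \<open>Words of a length other than two are sent to zero, because the value of \<open>G\<close> on the first two
  letters of a longer word is not multilinear in all letters. With this convention the contraction
  depends only on the tensor.\<close>

definition contract ::
  "('k::field \<Rightarrow> 'b::ab_group_add \<Rightarrow> 'b) \<Rightarrow> ('a \<Rightarrow> 'a \<Rightarrow> 'b) \<Rightarrow> ('a list \<Rightarrow>\<^sub>0 'k) \<Rightarrow> 'b" where
  "contract s G = lin_extend s (\<lambda>w. if length w = 2 then G (w ! 0) (w ! 1) else 0)"

context vector_space
begin

lemma lin_extend_superset:
  assumes "finite A" "Poly_Mapping.keys p \<subseteq> A"
  shows "lin_extend scale f p = (\<Sum>x\<in>A. scale (Poly_Mapping.lookup p x) (f x))"
  unfolding lin_extend_def using assms
  by (intro sum.mono_neutral_left) (auto simp: in_keys_iff)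

lemma linear_lin_extend: "Vector_Spaces.linear formal_scale scale (lin_extend scale f)"
  unfolding Vector_Spaces.linear_iff
proof (intro conjI allI)
  show "vector_space formal_scale" "vector_space scale"
    by unfold_locales
  fix p p' :: "'c \<Rightarrow>\<^sub>0 'a" and c
  let ?A = "Poly_Mapping.keys p \<union> Poly_Mapping.keys p'"
  have "lin_extend scale f (p + p') = (\<Sum>x\<in>?A. scale (Poly_Mapping.lookup (p + p') x) (f x))"
    by (rule lin_extend_superset) (auto dest: subsetD[OF Poly_Mapping.keys_add])
  also have "\<dots> = lin_extend scale f p + lin_extend scale f p'"
    using lin_extend_superset[of ?A p f] lin_extend_superset[of ?A p' f]
    by (simp add: lookup_add scale_left_distrib sum.distrib)
  finally show "lin_extend scale f (p + p') = lin_extend scale f p + lin_extend scale f p'" .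
  have "lin_extend scale f (formal_scale c p)
      = (\<Sum>x\<in>Poly_Mapping.keys p. scale (Poly_Mapping.lookup (formal_scale c p) x) (f x))"
    by (rule lin_extend_superset) (auto simp: in_keys_iff)
  then show "lin_extend scale f (formal_scale c p) = scale c (lin_extend scale f p)"
    by (simp add: lin_extend_def scale_sum_right)
qed

lemma lin_extend_single [simp]: "lin_extend scale f (Poly_Mapping.single w c) = scale c (f w)"
  by (simp add: lin_extend_def)

lemma linear_composed_lin_extend:
  assumes "Vector_Spaces.linear scale s' g"
  shows "g (lin_extend scale f p) = lin_extend s' (\<lambda>w. g (f w)) p"
  by (simp add: lin_extend_def linear_sum[OF assms] linear_scaleD[OF assms])

lemma linear_comp:
  "Vector_Spaces.linear scale s' f \<Longrightarrow> Vector_Spaces.linear s' s'' g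
    \<Longrightarrow> Vector_Spaces.linear scale s'' (\<lambda>x. g (f x))"
  by (simp add: Vector_Spaces.linear_iff)

end

lemma formal_sum_of_words: "p = lin_extend formal_scale word p"
  by (rule poly_mapping_eqI)
     (auto simp: lin_extend_def lookup_sum lookup_single when_def in_keys_iff
      if_distrib[where f = "(*) _"] sum.delta' cong: if_cong)

lemma linear_on_words:
  assumes "Vector_Spaces.linear formal_scale s F"
  shows "F p = lin_extend s (\<lambda>w. F (word w)) p"
  by (subst formal_sum_of_words) (rule formal.linear_composed_lin_extend[OF assms])

lemma tensor_relations_vanish:
  assumes "multilinear_on_words s s' F" "r \<in> tensor_relations s"
  shows "lin_extend s' F r = 0"
proof -
  have lin: "Vector_Spaces.linear s s' (\<lambda>x. F (u @ [x] @ w))" for u w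
    using assms(1) by (auto simp: multilinear_on_words_def)
  interpret vector_space s'
    using lin by (auto simp: Vector_Spaces.linear_iff)
  have ext: "Vector_Spaces.linear formal_scale s' (lin_extend s' F)"
    by (rule linear_lin_extend)
  have diff: "lin_extend s' F (p - p') = lin_extend s' F p - lin_extend s' F p'" for p p'
    using linear_addD[OF ext, of "p - p'" p'] by simp
  show ?thesis
    using assms(2) linear_addD[OF lin] linear_scaleD[OF lin]
    by (auto simp: tensor_relations_def diff linear_scaleD[OF ext])
qed

text \<open>The universal property of tensor powers.\<close>

lemma lin_extend_tensor_eq:
  fixes s :: "'k::field \<Rightarrow> 'a::ab_group_add \<Rightarrow> 'a"
  assumes "multilinear_on_words s s' F" "tensor_eq s p p'"
  shows "lin_extend s' F p = lin_extend s' F p'"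
proof -
  interpret vector_space s'
    using assms(1) by (auto simp: Vector_Spaces.linear_iff multilinear_on_words_def)
  have ext: "Vector_Spaces.linear formal_scale s' (lin_extend s' F)"
    by (rule linear_lin_extend)
  have zero: "Vector_Spaces.linear formal_scale s' (\<lambda>p :: 'a list \<Rightarrow>\<^sub>0 'k. 0)"
    using ext unfolding Vector_Spaces.linear_iff by simp
  have "lin_extend s' F (p - p') = 0"
    using linear_eq_on_spanning[OF ext zero _ assms(2)[unfolded tensor_eq_def]]
      tensor_relations_vanish[OF assms(1)] by blast
  then show ?thesis
    using linear_addD[OF ext, of "p - p'" p'] by simp
qed

lemma multilinear_on_pairs:
  assumes "bilinear_map s s' G"
  shows "multilinear_on_words s s' (\<lambda>w. if length w = 2 then G (w ! 0) (w ! 1) else 0)"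
  unfolding multilinear_on_words_def
proof (intro allI)
  fix u w :: "'b list"
  have G: "Vector_Spaces.linear s s' (\<lambda>x. G x y)" "Vector_Spaces.linear s s' (G x)" for x y
    using assms by (auto simp: bilinear_map_def)
  consider "length u + length w \<noteq> 1" | y where "u = []" "w = [y]" | x where "u = [x]" "w = []"
    by (cases u; cases w) auto
  then show "Vector_Spaces.linear s s' (\<lambda>x. if length (u @ [x] @ w) = 2
      then G ((u @ [x] @ w) ! 0) ((u @ [x] @ w) ! 1) else 0)"
  proof cases
    case 1
    then have "length (u @ [x] @ w) \<noteq> 2" for x
      by auto
    then show ?thesis
      using G(1) by (simp add: Vector_Spaces.linear_iff module.scale_zero_right vector_space_def module_def)
  qed (use G in auto)
qed

lemma contract_tensor_eq:
  "bilinear_map s s' G \<Longrightarrow> tensor_eq s p p' \<Longrightarrow> contract s' G p = contract s' G p'"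
  unfolding contract_def by (rule lin_extend_tensor_eq[OF multilinear_on_pairs])

lemma linear_contract: "vector_space s \<Longrightarrow> Vector_Spaces.linear formal_scale s (contract s G)"
  unfolding contract_def by (rule vector_space.linear_lin_extend)

lemma contract_pair [simp]:
  "vector_space s \<Longrightarrow> contract s G (Poly_Mapping.single [x, y] c) = s c (G x y)"
  by (simp add: contract_def vector_space.lin_extend_single)

lemma contract_pairs:
  assumes "Poly_Mapping.keys p \<subseteq> {w. length w = 2}"
  shows "contract s G p = lin_extend s (\<lambda>w. G (w ! 0) (w ! 1)) p"
  unfolding contract_def lin_extend_def using assms
  by (intro sum.cong) auto

lemma
  shows tensor_eq_refl: "tensor_eq s p p"
    and tensor_eq_sym: "tensor_eq s p p' \<Longrightarrow> tensor_eq s p' p"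
    and tensor_eq_trans: "tensor_eq s p p' \<Longrightarrow> tensor_eq s p' p'' \<Longrightarrow> tensor_eq s p p''"
    and tensor_eq_add: "tensor_eq s p p' \<Longrightarrow> tensor_eq s r r' \<Longrightarrow> tensor_eq s (p + r) (p' + r')"
    and tensor_eq_scale: "tensor_eq s p p' \<Longrightarrow> tensor_eq s (formal_scale c p) (formal_scale c p')"
  unfolding tensor_eq_def
  using formal.span_zero formal.span_neg[of "p - p'"] formal.span_add[of "p - p'"]
    formal.span_add[of "p - p'" _ "r - r'"] formal.span_scale[of "p - p'"]
  by (fastforce simp: algebra_simps formal.scale_right_diff_distrib)+

lemma tensor_eq_word_add:
  "tensor_eq s (word (u @ [x + y] @ w)) (word (u @ [x] @ w) + word (u @ [y] @ w))"
  unfolding tensor_eq_def tensor_relations_def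
  by (rule formal.span_base) (fastforce simp: algebra_simps)

lemma tensor_eq_word_scale:
  "tensor_eq s (word (u @ [s c x] @ w)) (formal_scale c (word (u @ [x] @ w)))"
  unfolding tensor_eq_def tensor_relations_def
  by (rule formal.span_base) blast

section \<open>Graded components\<close>

context graded_vector_space
begin

lemma component_decomposition: "homogeneous_decomposition H x (component H x)"
  unfolding component_def by (rule theI'[OF direct_sum])

lemma component_unique: "homogeneous_decomposition H x f \<Longrightarrow> component H x = f"
  unfolding component_def by (rule the1_equality[OF direct_sum])

lemma component_degree: "component H x m \<in> H m"
  and finite_component: "finite {m. component H x m \<noteq> 0}"
  and component_sum: "x = (\<Sum>m | component H x m \<noteq> 0. component H x m)"
  using component_decomposition by (auto simp: homogeneous_decomposition_def)

lemma component_homogeneous: "x \<in> H m \<Longrightarrow> component H x n = (if n = m then x else 0)"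
proof -
  assume "x \<in> H m"
  then have "homogeneous_decomposition H x (\<lambda>n. if n = m then x else 0)"
    by (cases "x = 0") (auto simp: homogeneous_decomposition_def subspace_0[OF subspace_degree])
  from component_unique[OF this] show ?thesis
    by simp
qed

text \<open>The componentwise sum of two decompositions is a decomposition of the sum, and decompositions
  are unique; likewise for scalar multiples.\<close>

lemma linear_component: "Vector_Spaces.linear scale scale (\<lambda>x. component H x m)"
  unfolding Vector_Spaces.linear_iff
proof (intro conjI allI vector_space_axioms)
  fix x y c
  let ?A = "{m. component H x m \<noteq> 0} \<union> {m. component H y m \<noteq> 0}"
  have A: "finite ?A"
    by (simp add: finite_component)
  have superset: "(\<Sum>m | component H z m \<noteq> 0. component H z m) = (\<Sum>m\<in>?A. component H z m)"
    if "{m. component H z m \<noteq> 0} \<subseteq> ?A" for z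
    using that A by (intro sum.mono_neutral_left) auto
  have "homogeneous_decomposition H (x + y) (\<lambda>m. component H x m + component H y m)"
    unfolding homogeneous_decomposition_def
  proof (intro conjI allI)
    show "component H x m + component H y m \<in> H m" for m
      by (intro subspace_add[OF subspace_degree] component_degree)
    show "finite {m. component H x m + component H y m \<noteq> 0}"
      by (rule finite_subset[OF _ A]) auto
    have "x + y = (\<Sum>m\<in>?A. component H x m + component H y m)"
      using component_sum[of x] component_sum[of y] superset[of x] superset[of y]
      by (simp add: sum.distrib)
    also have "\<dots> = (\<Sum>m | component H x m + component H y m \<noteq> 0. component H x m + component H y m)"
      using A by (intro sum.mono_neutral_right) auto
    finally show "x + y = \<dots>" .
  qed
  then show "component H (x + y) m = component H x m + component H y m"
    by (simp add: component_unique)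
  have "homogeneous_decomposition H (scale c x) (\<lambda>m. scale c (component H x m))"
    unfolding homogeneous_decomposition_def
  proof (intro conjI allI)
    show "scale c (component H x m) \<in> H m" for m
      by (intro subspace_scale[OF subspace_degree] component_degree)
    show "finite {m. scale c (component H x m) \<noteq> 0}"
      by (rule finite_subset[OF _ A]) auto
    have "scale c x = (\<Sum>m\<in>?A. scale c (component H x m))"
      using component_sum[of x] superset[of x] by (simp add: scale_sum_right[symmetric])
    also have "\<dots> = (\<Sum>m | scale c (component H x m) \<noteq> 0. scale c (component H x m))"
      using A by (intro sum.mono_neutral_right) auto
    finally show "scale c x = \<dots>" .
  qed
  then show "component H (scale c x) m = scale c (component H x m)"
    by (simp add: component_unique)
qed

text \<open>The range of summation depends on \<open>x\<close>; this is harmless since the omitted terms vanish. The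
  twisted product is made of sums of this kind.\<close>

lemma linear_sum_components:
  assumes "\<And>m. Vector_Spaces.linear scale s' (f m)"
  shows "Vector_Spaces.linear scale s' (\<lambda>x. \<Sum>m | component H x m \<noteq> 0. f m (component H x m))"
proof -
  interpret t: vector_space s'
    using assms by (auto simp: Vector_Spaces.linear_iff)
  have superset: "(\<Sum>m | component H x m \<noteq> 0. f m (component H x m)) = (\<Sum>m\<in>A. f m (component H x m))"
    if "finite A" "{m. component H x m \<noteq> 0} \<subseteq> A" for x A
    using that by (intro sum.mono_neutral_left) (auto simp: linear_zero[OF assms])
  show ?thesis
    unfolding Vector_Spaces.linear_iff
  proof (intro conjI allI vector_space_axioms t.vector_space_axioms)
    fix x y c
    let ?A = "{m. component H x m \<noteq> 0} \<union> {m. component H y m \<noteq> 0}"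
    show "(\<Sum>m | component H (x + y) m \<noteq> 0. f m (component H (x + y) m)) =
        (\<Sum>m | component H x m \<noteq> 0. f m (component H x m))
        + (\<Sum>m | component H y m \<noteq> 0. f m (component H y m))"
      by (subst (1 2 3) superset[of ?A])
        (auto simp: finite_component linear_addD[OF linear_component] linear_addD[OF assms] sum.distrib)
    show "(\<Sum>m | component H (scale c x) m \<noteq> 0. f m (component H (scale c x) m)) =
        s' c (\<Sum>m | component H x m \<noteq> 0. f m (component H x m))"
      by (subst (1 2) superset[of ?A])
        (auto simp: finite_component linear_scaleD[OF linear_component] linear_scaleD[OF assms]
          t.scale_sum_right)
  qed
qed

text \<open>A maximal independent set of homogeneous elements spans all homogeneous elements.\<close>

lemma homogeneous_basis:
  "\<exists>B. independent B \<and> span B = UNIV \<and> B \<subseteq> (\<Union>m. H m)"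
proof -
  obtain B where B: "B \<subseteq> (\<Union>m. H m)" "independent B" "(\<Union>m. H m) \<subseteq> span B"
    by (rule maximal_independent_subset)
  have "x \<in> span B" for x
    using B(3) component_degree by (subst component_sum) (blast intro: span_sum)
  then show ?thesis
    using B(1,2) by blast
qed

end

section \<open>Traces in terms of coordinates\<close>

text \<open>The trace of \<open>f = \<Sum>i. e i \<otimes> f (b i)\<close>, computed in the basis \<open>B\<close> of the definition, is
  \<open>\<Sum>i. e i (f (b i))\<close>. In particular it does not depend on \<open>B\<close>.\<close>

lemma (in vector_space) trace_on_coordinates:
  assumes "subspace U" "finite I"
    and e: "\<And>i. i \<in> I \<Longrightarrow> Vector_Spaces.linear scale (*) (e i)"
    and b: "\<And>i. i \<in> I \<Longrightarrow> b i \<in> U"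
    and expansion: "\<And>x. x \<in> U \<Longrightarrow> x = (\<Sum>i\<in>I. scale (e i x) (b i))"
    and f: "Vector_Spaces.linear scale scale f" "\<And>x. x \<in> U \<Longrightarrow> f x \<in> U"
  shows "trace_on scale U f = (\<Sum>i\<in>I. e i (f (b i)))"
proof -
  define B where "B = (SOME B. independent B \<and> span B = U)"
  have "\<exists>B. independent B \<and> span B = U"
    using maximal_independent_subset[of U] span_subspace[OF _ _ assms(1)] by metis
  then have "independent B \<and> span B = U"
    unfolding B_def by (rule someI_ex)
  then have B: "independent B" "span B = U"
    by blast+
  have "B \<subseteq> span (b ` I)"
  proof
    fix c assume "c \<in> B"
    then have "c \<in> U"
      using B(2) span_base by blast
    then show "c \<in> span (b ` I)"
      by (subst expansion[of c]) (assumption, intro span_sum span_scale span_base imageI)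
  qed
  then have fin: "finite B"
    using independent_span_bound[OF finite_imageI[OF assms(2)] B(1)] by blast
  have "representation B (f c) c = (\<Sum>i\<in>I. e i (scale (representation B (f (b i)) c) c))" if c: "c \<in> B" for c
  proof -
    have cU: "c \<in> U"
      using B(2) span_base[OF c] by simp
    have "representation B (f c) c = representation B (\<Sum>i\<in>I. scale (e i c) (f (b i))) c"
      by (subst expansion[OF cU]) (simp only: linear_sum[OF f(1)] linear_scaleD[OF f(1)])
    also have "\<dots> = (\<Sum>i\<in>I. e i c * representation B (f (b i)) c)"
      using b f(2) B by (subst representation_sum) (auto simp: span_scale representation_scale)
    also have "\<dots> = (\<Sum>i\<in>I. e i (scale (representation B (f (b i)) c) c))"
      by (intro sum.cong refl) (simp add: linear_scaleD[OF e] mult.commute)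
    finally show ?thesis .
  qed
  then have "trace_on scale U f = (\<Sum>c\<in>B. \<Sum>i\<in>I. e i (scale (representation B (f (b i)) c) c))"
    by (simp add: trace_on_def B_def[symmetric] Let_def)
  also have "\<dots> = (\<Sum>i\<in>I. e i (\<Sum>c\<in>B. scale (representation B (f (b i)) c) c))"
    by (subst sum.swap) (simp add: linear_sum[OF e])
  also have "\<dots> = (\<Sum>i\<in>I. e i (f (b i)))"
    using B b f(2) fin by (intro sum.cong refl) (simp add: sum_representation_eq)
  finally show ?thesis .
qed

section \<open>Palindromes in a graded alphabet\<close>

lemma choose_2_add: "(a + b :: nat) choose 2 = (a choose 2) + (b choose 2) + a * b"
  by (induction a) (simp_all add: numeral_2_eq_2)

locale graded_letters =
  fixes B :: "'w set" and deg :: "'w \<Rightarrow> nat"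
begin

definition word_degree :: "'w list \<Rightarrow> nat" where
  "word_degree w = sum_list (map deg w)"

lemma word_degree_simps [simp]:
  "word_degree [] = 0" "word_degree (x # w) = deg x + word_degree w"
  "word_degree (u @ w) = word_degree u + word_degree w" "word_degree (rev w) = word_degree w"
  by (simp_all add: word_degree_def rev_map[symmetric])

definition words :: "nat \<Rightarrow> 'w list set" where
  "words m = {w \<in> lists B. word_degree w = m}"

lemma words_in_lists: "words m \<subseteq> lists B"
  by (auto simp: words_def)

text \<open>The exponent of \<open>q\<close> that results from reversing a word by braiding each pair of its letters:
  the sum of \<open>deg x * deg y\<close> over all pairs of positions.\<close>

fun inversion_degree :: "'w list \<Rightarrow> nat" where
  "inversion_degree [] = 0"
| "inversion_degree (x # w) = deg x * word_degree w + inversion_degree w"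

lemma inversion_degree_snoc: "inversion_degree (w @ [x]) = inversion_degree w + word_degree w * deg x"
  by (induction w) (simp_all add: algebra_simps)

text \<open>The normalization \<open>q ^ (m choose 2)\<close> absorbs the interaction of the letters: what remains is
  a product over the letters.\<close>

lemma word_degree_choose_2:
  fixes q :: "'k::field"
  assumes "q \<noteq> 0"
  shows "q ^ inversion_degree w / q ^ (word_degree w choose 2) = (\<Prod>b\<leftarrow>w. 1 / q ^ (deg b choose 2))"
proof (induction w)
  case (Cons b w)
  then show ?case
    using assms by (simp add: choose_2_add power_add flip: Cons)
qed (simp add: numeral_2_eq_2)

definition palindromes :: "nat \<Rightarrow> 'w list set" where
  "palindromes m = {w \<in> words m. rev w = w}"

lemma long_palindromes:
  "{w \<in> palindromes m. 2 \<le> length w} =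
     (\<lambda>(i, b, p). b # p @ [b]) ` (SIGMA i:{..m}. {b \<in> B. 2 * deg b = i} \<times> palindromes (m - i))"
  (is "?L = ?f ` ?R")
proof
  show "?L \<subseteq> ?f ` ?R"
  proof
    fix w assume w: "w \<in> ?L"
    obtain b w' where w': "w = b # w'" "w' \<noteq> []"
      using w by (cases w; cases "tl w") auto
    obtain p c where p: "w' = p @ [c]"
      using w'(2) by (cases w' rule: rev_cases) auto
    have "rev (b # p @ [c]) = b # p @ [c]"
      using w unfolding w'(1) p palindromes_def by blast
    then have rev: "c # (rev p @ [b]) = b # (p @ [c])"
      by (simp only: rev.simps rev_append append_Cons append_Nil append_assoc)
    then have "c = b"
      by (rule list.inject[THEN iffD1, THEN conjunct1])
    then have "w = b # p @ [b]" "rev p = p"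
      using w'(1) p rev by auto
    with w have "w = ?f (2 * deg b, b, p)" "(2 * deg b, b, p) \<in> ?R"
      by (auto simp: palindromes_def words_def)
    then show "w \<in> ?f ` ?R"
      by (rule image_eqI)
  qed
  show "?f ` ?R \<subseteq> ?L"
    by (auto simp: palindromes_def words_def)
qed

text \<open>The three summands come from the empty word, the letters, and the palindromes \<open>b p b\<close>. Adding
  \<open>b\<close> at both ends leaves the sign unchanged and multiplies the weight by \<open>(g b)\<^sup>2\<close>.\<close>

lemma sum_palindromes:
  fixes g :: "'w \<Rightarrow> 'k::field"
  assumes finite: "\<And>m. finite (words m)" and positive: "\<And>b. b \<in> B \<Longrightarrow> deg b > 0"
  defines "wt \<equiv> \<lambda>w. (-1) ^ length w * (\<Prod>b\<leftarrow>w. g b)"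
  shows "(\<Sum>w\<in>palindromes m. wt w) = of_bool (m = 0) - (\<Sum>b | b \<in> B \<and> deg b = m. g b) +
    (\<Sum>i\<le>m. (\<Sum>b | b \<in> B \<and> 2 * deg b = i. (g b)\<^sup>2) * (\<Sum>w\<in>palindromes (m - i). wt w))"
proof -
  have fin_pal: "finite (palindromes m)" for m
    using finite by (simp add: palindromes_def)
  have "finite ((\<lambda>b. [b]) ` {b \<in> B. deg b = n})" for n
    by (rule finite_subset[OF _ finite[of n]]) (auto simp: words_def)
  then have fin_letters: "finite {b \<in> B. deg b = n}" for n
    by (rule finite_imageD) (simp add: inj_on_def)
  have fin_double: "finite {b \<in> B. 2 * deg b = i}" for i
    by (rule finite_subset[OF _ fin_letters[of "i div 2"]]) auto
  let ?E = "{w \<in> palindromes m. w = []}"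
  let ?S = "{w \<in> palindromes m. length w = 1}"
  let ?L = "{w \<in> palindromes m. 2 \<le> length w}"
  let ?f = "\<lambda>(i :: nat, b, p). b # p @ [b]"
  let ?R = "SIGMA i:{..m}. {b \<in> B. 2 * deg b = i} \<times> palindromes (m - i)"
  have "w = [] \<or> length w = 1 \<or> 2 \<le> length w" for w :: "'w list"
    by (cases w; cases "tl w") auto
  then have split: "palindromes m = (?E \<union> ?S) \<union> ?L"
    by blast
  have "(\<Sum>w\<in>palindromes m. wt w) = (\<Sum>w\<in>?E. wt w) + (\<Sum>w\<in>?S. wt w) + (\<Sum>w\<in>?L. wt w)"
    by (subst split, subst sum.union_disjoint, simp add: fin_pal, simp add: fin_pal, force,
        subst sum.union_disjoint) (auto simp: fin_pal)
  also have "?E = (if m = 0 then {[]} else {})"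
    by (auto simp: palindromes_def words_def)
  then have "(\<Sum>w\<in>?E. wt w) = of_bool (m = 0)"
    by (simp add: wt_def)
  also have "?S = (\<lambda>b. [b]) ` {b \<in> B. deg b = m}"
    by (auto simp: palindromes_def words_def length_Suc_conv)
  then have "(\<Sum>w\<in>?S. wt w) = - (\<Sum>b | b \<in> B \<and> deg b = m. g b)"
    by (simp add: sum.reindex inj_on_def wt_def sum_negf)
  also have "(\<Sum>w\<in>?L. wt w) = (\<Sum>x\<in>?R. wt (?f x))"
    unfolding long_palindromes by (subst sum.reindex) (auto simp: inj_on_def)
  also have "\<dots> = (\<Sum>i\<le>m. \<Sum>(b, p)\<in>{b \<in> B. 2 * deg b = i} \<times> palindromes (m - i). wt (b # p @ [b]))"
    by (subst sum.Sigma) (auto simp: fin_pal fin_double split_beta)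
  also have "\<dots> = (\<Sum>i\<le>m. (\<Sum>b | b \<in> B \<and> 2 * deg b = i. (g b)\<^sup>2) * (\<Sum>w\<in>palindromes (m - i). wt w))"
    unfolding sum_product sum.cartesian_product
    by (intro sum.cong refl) (auto simp: wt_def power2_eq_square)
  finally show ?thesis
    by simp
qed

end

section \<open>The basis of words of a cofree q-Hopf algebra\<close>

text \<open>The isomorphism, the homogeneous basis \<open>B\<close> of \<open>W\<close> and the degrees of its elements are fixed as
  parameters, so that words, their degrees and coordinates can be named.\<close>

locale cofree_q_hopf_algebra =
  q_hopf_algebra scale H \<Delta> \<epsilon> q S + W: graded_vector_space scaleW W + graded_letters B deg
  for scale :: "'k::field \<Rightarrow> 'a::ring_1 \<Rightarrow> 'a" and H \<Delta> \<epsilon> q S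
    and scaleW :: "'k \<Rightarrow> 'w::ab_group_add \<Rightarrow> 'w" and W and B :: "'w set" and deg +
  fixes \<Psi> :: "('w list \<Rightarrow>\<^sub>0 'k) \<Rightarrow> 'a"
  assumes iso: "deconcatenation_isomorphism scaleW W scale H \<Delta> \<epsilon> \<Psi>"
    and connected: "dim (H 0) = 1"
    and finite_components: "finite_dimensional scale (H m)"
    and letters_independent: "W.independent B"
    and letters_span: "W.span B = UNIV"
    and letters_degree: "b \<in> B \<Longrightarrow> b \<in> W (deg b)"
begin

abbreviation bas :: "'w list \<Rightarrow> 'a" where
  "bas w \<equiv> \<Psi> (word w)"

lemma linear_\<Psi>: "Vector_Spaces.linear formal_scale scale \<Psi>"
  and \<Psi>_eq_iff: "\<Psi> p = \<Psi> p' \<longleftrightarrow> tensor_eq scaleW p p'"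
  and surj_\<Psi>: "surj \<Psi>"
  and \<Psi>_degree: "list_all2 (\<lambda>x n. x \<in> W n) w ns \<Longrightarrow> bas w \<in> H (sum_list ns)"
  and \<Psi>_comult: "tensor_eq scale (\<Delta> (\<Psi> p)) (tensor_map \<Psi> (deconcatenation p))"
  and \<Psi>_counit: "\<epsilon> (\<Psi> p) = Poly_Mapping.lookup p []"
  using iso by (auto simp: deconcatenation_isomorphism_def)

lemma \<Psi>_words: "\<Psi> p = lin_extend scale bas p"
  by (rule linear_on_words[OF linear_\<Psi>])

lemma linear_bas_letter: "Vector_Spaces.linear scaleW scale (\<lambda>x. bas (u @ [x] @ w))"
  unfolding Vector_Spaces.linear_iff
proof (intro conjI allI vector_space_axioms W.vector_space_axioms)
  fix x y c
  have "bas (u @ [x + y] @ w) = \<Psi> (word (u @ [x] @ w) + word (u @ [y] @ w))"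
    unfolding \<Psi>_eq_iff by (rule tensor_eq_word_add)
  then show "bas (u @ [x + y] @ w) = bas (u @ [x] @ w) + bas (u @ [y] @ w)"
    by (simp add: linear_addD[OF linear_\<Psi>])
  have "bas (u @ [scaleW c x] @ w) = \<Psi> (formal_scale c (word (u @ [x] @ w)))"
    unfolding \<Psi>_eq_iff by (rule tensor_eq_word_scale)
  then show "bas (u @ [scaleW c x] @ w) = scale c (bas (u @ [x] @ w))"
    by (simp add: linear_scaleD[OF linear_\<Psi>])
qed

text \<open>By induction, the letters after the prefix \<open>u\<close> are expanded in the basis \<open>B\<close> one by one.\<close>

lemma bas_in_span: "u \<in> lists B \<Longrightarrow> bas (u @ w) \<in> span (bas ` lists B)"
proof (induction w arbitrary: u)
  case Nil
  then show ?case
    by (auto intro: span_base)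
next
  case (Cons x w)
  have "x \<in> W.span B"
    by (simp add: letters_span)
  then have "bas (u @ [x] @ w) \<in> span (bas ` lists B)"
  proof (induction rule: W.span_induct_alt)
    case base
    then show ?case
      by (simp add: linear_zero[OF linear_bas_letter, simplified] span_zero)
  next
    case (step c b y)
    have "bas (u @ [b] @ w) \<in> span (bas ` lists B)"
      using Cons.IH[of "u @ [b]"] Cons.prems step by simp
    then show ?case
      using step by (simp only: linear_addD[OF linear_bas_letter] linear_scaleD[OF linear_bas_letter])
        (intro span_add span_scale)
  qed
  then show ?case
    by simp
qed

lemma span_words: "x \<in> span (bas ` lists B)"
proof -
  obtain p where "x = \<Psi> p"
    using surj_\<Psi> by (auto simp: surj_def)
  also have "\<Psi> p \<in> span (bas ` lists B)"
    using bas_in_span[of "[]"] unfolding \<Psi>_words[of p] lin_extend_def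
    by (intro span_sum span_scale) simp
  finally show ?thesis .
qed

text \<open>The tensor product of the coordinate functionals of the letters of the first word, evaluated
  at a second word, whose letters are arbitrary elements of \<open>W\<close>.\<close>

fun word_coordinate :: "'w list \<Rightarrow> 'w list \<Rightarrow> 'k" where
  "word_coordinate [] [] = 1"
| "word_coordinate (b # w) (x # u) = W.representation B x b * word_coordinate w u"
| "word_coordinate _ _ = 0"

lemma linear_word_coordinate:
  "Vector_Spaces.linear scaleW (*) (\<lambda>x. word_coordinate w (u @ [x] @ u'))"
proof (induction u arbitrary: w)
  case Nil
  have "Vector_Spaces.linear scaleW (*) (\<lambda>x. W.representation B x b)" for b
    using W.linear_representation[OF letters_independent letters_span] .
  then show ?case
    by (cases w) (simp_all add: linear_functional_mult W.linear_functional_zero)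
next
  case (Cons y u)
  then show ?case
    by (cases w) (simp_all add: linear_functional_mult W.linear_functional_zero)
qed

text \<open>The choice of a preimage under \<open>\<Psi>\<close> is immaterial, because \<open>word_coordinate w\<close> is multilinear
  and preimages are unique up to tensor relations.\<close>

definition coordinate :: "'w list \<Rightarrow> 'a \<Rightarrow> 'k" where
  "coordinate w x = lin_extend (*) (word_coordinate w) (inv \<Psi> x)"

lemma coordinate_\<Psi>: "coordinate w (\<Psi> p) = lin_extend (*) (word_coordinate w) p"
proof -
  have "multilinear_on_words scaleW (*) (word_coordinate w)"
    by (simp add: multilinear_on_words_def linear_word_coordinate[simplified])
  moreover have "tensor_eq scaleW (inv \<Psi> (\<Psi> p)) p"
    by (simp add: \<Psi>_eq_iff[symmetric] surj_f_inv_f[OF surj_\<Psi>])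
  ultimately show ?thesis
    unfolding coordinate_def by (rule lin_extend_tensor_eq)
qed

lemma linear_coordinate: "Vector_Spaces.linear scale (*) (coordinate w)"
  unfolding Vector_Spaces.linear_iff
proof (intro conjI allI vector_space_axioms field.vector_space_axioms)
  fix x y c
  obtain p p' where [simp]: "x = \<Psi> p" "y = \<Psi> p'"
    using surj_\<Psi> by (metis surjD)
  have "coordinate w (x + y) = coordinate w (\<Psi> (p + p'))"
    by (simp add: linear_addD[OF linear_\<Psi>])
  then show "coordinate w (x + y) = coordinate w x + coordinate w y"
    by (simp add: coordinate_\<Psi> linear_addD[OF field.linear_lin_extend])
  have "coordinate w (scale c x) = coordinate w (\<Psi> (formal_scale c p))"
    by (simp add: linear_scaleD[OF linear_\<Psi>])
  then show "coordinate w (scale c x) = c * coordinate w x"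
    by (simp add: coordinate_\<Psi> linear_scaleD[OF field.linear_lin_extend])
qed

lemma coordinate_bas:
  assumes "w \<in> lists B" "u \<in> lists B"
  shows "coordinate w (bas u) = of_bool (w = u)"
proof -
  have "coordinate w (bas u) = word_coordinate w u"
    by (simp add: coordinate_\<Psi> field.lin_extend_single)
  also have "\<dots> = of_bool (w = u)"
    using assms by (induction w u rule: word_coordinate.induct)
      (auto simp: W.representation_basis[OF letters_independent])
  finally show ?thesis .
qed

lemma bas_degree: "w \<in> lists B \<Longrightarrow> bas w \<in> H (word_degree w)"
  unfolding word_degree_def using letters_degree
  by (intro \<Psi>_degree) (induction w; auto)

lemma bas_ne_0: "w \<in> lists B \<Longrightarrow> bas w \<noteq> 0"
  using coordinate_bas[of w w] linear_zero[OF linear_coordinate[of w]] by auto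

lemma inj_bas: "inj_on bas (lists B)"
proof (rule inj_onI)
  fix w u assume "w \<in> lists B" "u \<in> lists B" "bas w = bas u"
  then show "w = u"
    using coordinate_bas[of w w] coordinate_bas[of w u] by (simp split: if_splits)
qed

lemma independent_bas: "A \<subseteq> lists B \<Longrightarrow> independent (bas ` A)"
proof (rule independent_mono[of "bas ` lists B"])
  show "independent (bas ` lists B)"
    unfolding independent_explicit_module
  proof (intro allI impI)
    fix t u v assume t: "finite t" "t \<subseteq> bas ` lists B" "(\<Sum>v\<in>t. scale (u v) v) = 0" "v \<in> t"
    then obtain w where w: "w \<in> lists B" "v = bas w"
      by blast
    have "coordinate w v' = of_bool (v' = v)" if v': "v' \<in> t" for v'
    proof -
      obtain w' where "w' \<in> lists B" "v' = bas w'"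
        using v' t(2) by blast
      then show ?thesis
        using w inj_on_eq_iff[OF inj_bas, of w w'] by (simp add: coordinate_bas eq_commute)
    qed
    then have "(\<Sum>v'\<in>t. u v' * of_bool (v' = v)) = coordinate w (\<Sum>v\<in>t. scale (u v) v)"
      by (simp add: linear_sum[OF linear_coordinate] linear_scaleD[OF linear_coordinate])
    then show "u v = 0"
      using t by (simp add: linear_zero[OF linear_coordinate] of_bool_def sum.delta'
        if_distrib[where f = "(*) _"] cong: if_cong)
  qed
qed auto

text \<open>The words of degree \<open>m\<close> give independent elements of the finite-dimensional space \<open>H m\<close>.\<close>

lemma finite_words: "finite (words m)"
proof -
  obtain C where "finite C" "H m = span C"
    using finite_components by (auto simp: finite_dimensional_def)
  moreover have "bas ` words m \<subseteq> H m"
    using bas_degree by (auto simp: words_def)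
  ultimately have "finite (bas ` words m)"
    using independent_span_bound[of C "bas ` words m"] independent_bas[of "words m"]
    by (auto simp: words_def)
  then show ?thesis
    by (rule finite_imageD) (rule inj_on_subset[OF inj_bas], auto simp: words_def)
qed

text \<open>Both sides, with \<open>x\<close> replaced by its component of degree \<open>m\<close> on the left, are linear in \<open>x\<close>
  and agree on basis words.\<close>

lemma homogeneous_expansion:
  assumes "x \<in> H m"
  shows "x = (\<Sum>w\<in>words m. scale (coordinate w x) (bas w))"
proof -
  have component_bas: "component H (bas w) m = (if w \<in> words m then bas w else 0)" if "w \<in> lists B" for w
    using component_homogeneous[OF bas_degree[OF that], of m] that by (auto simp: words_def)
  have lin: "Vector_Spaces.linear scale scale (\<lambda>x. \<Sum>w\<in>words m. scale (coordinate w x) (bas w))"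
    by (simp add: Vector_Spaces.linear_iff vector_space_axioms linear_addD[OF linear_coordinate]
      linear_scaleD[OF linear_coordinate] scale_left_distrib sum.distrib scale_sum_right)
  have "component H x m = (\<Sum>w\<in>words m. scale (coordinate w x) (bas w))"
  proof (rule linear_eq_on_spanning[OF linear_component lin _ span_words])
    fix b assume "b \<in> bas ` lists B"
    then obtain u where u: "u \<in> lists B" "b = bas u"
      by blast
    have "(\<Sum>w\<in>words m. scale (coordinate w b) (bas w)) = (\<Sum>w\<in>words m. if w = u then bas u else 0)"
      using u by (intro sum.cong) (auto simp: words_def coordinate_bas)
    then show "component H b m = (\<Sum>w\<in>words m. scale (coordinate w b) (bas w))"
      using u finite_words by (simp add: component_bas)
  qed
  then show ?thesis
    using component_homogeneous[OF assms, of m] by simp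
qed

lemma span_bas_words: "span (bas ` words m) = H m"
proof
  show "span (bas ` words m) \<subseteq> H m"
    by (rule span_minimal[OF _ subspace_degree]) (auto simp: words_def simp del: in_lists_conv_set intro: bas_degree)
  show "H m \<subseteq> span (bas ` words m)"
  proof
    fix x assume "x \<in> H m"
    then show "x \<in> span (bas ` words m)"
      by (subst homogeneous_expansion[of x m]) (assumption, intro span_sum span_scale span_base imageI)
  qed
qed

text \<open>This is where connectedness enters: it excludes letters of degree zero.\<close>

lemma words_0: "words 0 = {[]}"
proof -
  have "dim (H 0) = card (bas ` words 0)"
    by (rule dim_eq_card[OF _ independent_bas])
      (simp_all add: span_bas_words span_eq_iff[THEN iffD2] subspace_degree words_in_lists)
  then have "card (words 0) = 1"
    using connected card_image[OF inj_on_subset[OF inj_bas words_in_lists], of 0] by simp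
  moreover have "[] \<in> words 0"
    by (simp add: words_def)
  ultimately show ?thesis
    by (metis card_1_singletonE singletonD)
qed

lemma letters_positive: "b \<in> B \<Longrightarrow> deg b > 0"
proof (rule ccontr)
  assume "b \<in> B" "\<not> deg b > 0"
  then have "[b] \<in> words 0"
    by (simp add: words_def)
  then show False
    by (simp add: words_0)
qed

lemma one_bas: "1 = bas []"
proof -
  have one: "1 = scale (coordinate [] 1) (bas [])"
    using homogeneous_expansion[OF one_degree] words_0 by simp
  have "\<epsilon> 1 = coordinate [] 1 * \<epsilon> (bas [])"
    by (subst one) (rule linear_scaleD[OF counit_linear])
  then show ?thesis
    using one by (simp add: counit_one \<Psi>_counit)
qed

end

section \<open>The coproduct in the basis of words\<close>

context cofree_q_hopf_algebra
begin

lemma \<Psi>_comult_bas: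
  "tensor_eq scale (\<Delta> (bas w)) (\<Sum>i\<le>length w. word [bas (take i w), bas (drop i w)])"
proof -
  have "deconcatenation (word w :: 'w list \<Rightarrow>\<^sub>0 'k) = (\<Sum>i\<le>length w. word [word (take i w), word (drop i w)])"
    by (simp add: deconcatenation_def formal.lin_extend_single)
  then have "tensor_map \<Psi> (deconcatenation (word w)) =
      (\<Sum>i\<le>length w. word [bas (take i w), bas (drop i w)])"
    by (simp add: tensor_map_def linear_sum[OF formal.linear_lin_extend] formal.lin_extend_single)
  then show ?thesis
    using \<Psi>_comult[of "word w"] by simp
qed

lemma contract_comult_bas:
  assumes "bilinear_map scale s' G"
  shows "contract s' G (\<Delta> (bas w)) = (\<Sum>i\<le>length w. G (bas (take i w)) (bas (drop i w)))"
proof -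
  interpret t: vector_space s'
    using assms unfolding bilinear_map_def Vector_Spaces.linear_iff by blast
  show ?thesis
    unfolding contract_tensor_eq[OF assms \<Psi>_comult_bas]
      linear_sum[OF linear_contract[OF t.vector_space_axioms]]
    by (simp add: t.vector_space_axioms)
qed

lemma linear_contract_comult:
  assumes "bilinear_map scale s' G"
  shows "Vector_Spaces.linear scale s' (\<lambda>x. contract s' G (\<Delta> x))"
proof -
  have s': "vector_space s'"
    using assms unfolding bilinear_map_def Vector_Spaces.linear_iff by blast
  show ?thesis
    unfolding Vector_Spaces.linear_iff
    using contract_tensor_eq[OF assms comult_add] contract_tensor_eq[OF assms comult_scale]
    by (simp add: vector_space_axioms s' linear_addD[OF linear_contract[OF s']]
      linear_scaleD[OF linear_contract[OF s']])
qed

lemma linear_mult: "Vector_Spaces.linear scale scale (\<lambda>x. x * y)"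
  "Vector_Spaces.linear scale scale ((*) x)"
  by (simp_all add: Vector_Spaces.linear_iff vector_space_axioms algebra_simps scale_mult_left scale_mult_right)

lemma bilinear_coordinates:
  "bilinear_map scale (*) (\<lambda>x y. coordinate w1 x * coordinate w2 y)"
  by (simp add: bilinear_map_def linear_functional_mult[OF linear_coordinate])

text \<open>Deconcatenation is dual to the concatenation of words.\<close>

lemma coordinate_append:
  assumes "w1 \<in> lists B" "w2 \<in> lists B"
  shows "coordinate (w1 @ w2) x = contract (*) (\<lambda>x y. coordinate w1 x * coordinate w2 y) (\<Delta> x)"
proof (rule linear_eq_on_spanning[OF linear_coordinate linear_contract_comult[OF bilinear_coordinates] _ span_words])
  fix b assume "b \<in> bas ` lists B"
  then obtain u where u: "u \<in> lists B" "b = bas u"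
    by blast
  have sub: "take i u \<in> lists B" "drop i u \<in> lists B" for i
    using u by (auto dest: in_set_takeD in_set_dropD)
  have "(\<Sum>i\<le>length u. coordinate w1 (bas (take i u)) * coordinate w2 (bas (drop i u)))
      = (\<Sum>i\<le>length u. if i = length w1 then of_bool (w1 @ w2 = u) else 0)"
  proof (intro sum.cong refl)
    fix i assume "i \<in> {..length u}"
    then show "coordinate w1 (bas (take i u)) * coordinate w2 (bas (drop i u))
        = (if i = length w1 then of_bool (w1 @ w2 = u) else 0)"
      unfolding coordinate_bas[OF assms(1) sub(1)] coordinate_bas[OF assms(2) sub(2)]
        append_eq_conv_conj by auto
  qed
  also have "\<dots> = of_bool (w1 @ w2 = u)"
    by auto
  finally show "coordinate (w1 @ w2) b =
      contract (*) (\<lambda>x y. coordinate w1 x * coordinate w2 y) (\<Delta> b)"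
    using u assms by (simp add: contract_comult_bas[OF bilinear_coordinates] coordinate_bas)
qed

lemma subspace_primitives: "subspace (primitives scale \<Delta>)"
proof -
  define D :: "'a \<Rightarrow> 'a list \<Rightarrow>\<^sub>0 'k" where "D x = word [1, x] + word [x, 1]" for x
  have D_add: "tensor_eq scale (D (x + y)) (D x + D y)" for x y
    using tensor_eq_add[OF tensor_eq_word_add[of scale "[1]" x y "[]"] tensor_eq_word_add[of scale "[]" x y "[1]"]]
    by (simp add: D_def algebra_simps)
  have D_scale: "tensor_eq scale (D (scale c x)) (formal_scale c (D x))" for c x
    using tensor_eq_add[OF tensor_eq_word_scale[of scale "[1]" c x "[]"] tensor_eq_word_scale[of scale "[]" c x "[1]"]]
    by (simp add: D_def formal.scale_right_distrib)
  have primitives: "primitives scale \<Delta> = {x. tensor_eq scale (\<Delta> x) (D x)}"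
    by (simp add: primitives_def D_def)
  have scale: "scale c x \<in> primitives scale \<Delta>" if "tensor_eq scale (\<Delta> x) (D x) \<or> c = 0" for c x
  proof -
    have "tensor_eq scale (formal_scale c (\<Delta> x)) (formal_scale c (D x))"
      using that by (auto intro: tensor_eq_scale tensor_eq_refl)
    then show ?thesis
      unfolding primitives using comult_scale D_scale
      by (blast intro: tensor_eq_trans tensor_eq_sym)
  qed
  show ?thesis
  proof (rule subspaceI)
    show "0 \<in> primitives scale \<Delta>"
      using scale[of 0 0] by simp
    show "x + y \<in> primitives scale \<Delta>" if "x \<in> primitives scale \<Delta>" "y \<in> primitives scale \<Delta>" for x y
      using that unfolding primitives mem_Collect_eq
      by (blast intro: tensor_eq_trans[OF comult_add] tensor_eq_trans[OF _ tensor_eq_sym[OF D_add]] tensor_eq_add)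
    show "scale c x \<in> primitives scale \<Delta>" if "x \<in> primitives scale \<Delta>" for c x
      using that scale[of x c] by (simp add: primitives)
  qed
qed

text \<open>A word of length at least two splits into two nonempty words, whose coefficient in
  \<open>1 \<otimes> x + x \<otimes> 1\<close> is zero. For the empty word the two summands give \<open>c = c + c\<close>.\<close>

lemma primitive_coordinate:
  assumes "x \<in> primitives scale \<Delta>" "w \<in> lists B" "length w \<noteq> 1"
  shows "coordinate w x = 0"
proof -
  have append: "coordinate (u @ v) x = of_bool (u = []) * coordinate v x + coordinate u x * of_bool (v = [])"
    if "u \<in> lists B" "v \<in> lists B" for u v
  proof -
    have one: "coordinate w 1 = of_bool (w = [])" if "w \<in> lists B" for w
      using coordinate_bas[OF that, of "[]"] by (simp add: one_bas)
    have "coordinate (u @ v) x = contract (*) (\<lambda>x y. coordinate u x * coordinate v y) (\<Delta> x)"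
      by (rule coordinate_append[OF that])
    also have "\<dots> = contract (*) (\<lambda>x y. coordinate u x * coordinate v y) (word [1, x] + word [x, 1])"
      using assms(1) by (intro contract_tensor_eq[OF bilinear_coordinates]) (simp add: primitives_def)
    also have "\<dots> = coordinate u 1 * coordinate v x + coordinate u x * coordinate v 1"
      by (simp add: linear_addD[OF linear_contract] field.vector_space_axioms)
    finally show ?thesis
      using that by (simp add: one)
  qed
  consider "w = []" | a b w' where "w = a # b # w'"
    using assms(3) by (cases w rule: remdups_adj.cases) auto
  then show ?thesis
  proof cases
    case 1
    have "coordinate [] x = coordinate [] x + coordinate [] x"
      using append[of "[]" "[]"] by (simp only: append_Nil of_bool_eq mult_1_left mult_1_right lists.Nil simp_thms)
    then show ?thesis
      unfolding 1 by (simp only: add_cancel_right_right)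
  next
    case 2
    then show ?thesis
      using append[of "[a]" "b # w'"] assms(2) by simp
  qed
qed

lemma dim_primitives: "dim (primitives scale \<Delta> \<inter> H n) = card {b \<in> B. deg b = n}"
proof -
  let ?A = "(\<lambda>b. [b]) ` {b \<in> B. deg b = n}"
  have A: "?A \<subseteq> words n" "?A \<subseteq> lists B"
    by (auto simp: words_def)
  have "span (bas ` ?A) = primitives scale \<Delta> \<inter> H n"
  proof
    have "bas [b] \<in> primitives scale \<Delta>" if "b \<in> B" for b
      using \<Psi>_comult_bas[of "[b]"] by (simp add: primitives_def one_bas)
    moreover have "bas [b] \<in> H (deg b)" if "b \<in> B" for b
      using bas_degree[of "[b]"] that by simp
    ultimately have "bas ` ?A \<subseteq> primitives scale \<Delta> \<inter> H n"
      by blast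
    then show "span (bas ` ?A) \<subseteq> primitives scale \<Delta> \<inter> H n"
      by (intro span_minimal subspace_inter subspace_primitives subspace_degree)
    show "primitives scale \<Delta> \<inter> H n \<subseteq> span (bas ` ?A)"
    proof
      fix x assume x: "x \<in> primitives scale \<Delta> \<inter> H n"
      have "scale (coordinate w x) (bas w) \<in> span (bas ` ?A)" if w: "w \<in> words n" for w
      proof (cases "length w = 1")
        case True
        then have "w \<in> ?A"
          using w by (auto simp: words_def length_Suc_conv)
        then show ?thesis
          by (intro span_scale span_base imageI)
      next
        case False
        then show ?thesis
          using x w primitive_coordinate[of x w] by (simp add: words_def span_zero)
      qed
      then show "x \<in> span (bas ` ?A)"
        using x by (subst homogeneous_expansion[of x n]) (auto intro: span_sum)
    qed
  qed
  then have "dim (primitives scale \<Delta> \<inter> H n) = card (bas ` ?A)"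
    using independent_bas[OF A(2)] by (metis dim_eq_card span_span)
  also have "\<dots> = card {b \<in> B. deg b = n}"
    using inj_on_subset[OF inj_bas A(2)] by (simp add: card_image inj_on_def)
  finally show ?thesis .
qed

end

section \<open>The product up to shorter words\<close>

context cofree_q_hopf_algebra
begin

definition mult_coefficient :: "'w list \<Rightarrow> 'w list \<Rightarrow> 'w list \<Rightarrow> 'k" where
  "mult_coefficient u v w = coordinate w (bas u * bas v)"

context
  fixes w1 w2 :: "'w list"
begin

text \<open>The coefficient of \<open>w1 \<otimes> w2\<close> in the twisted product of \<open>a \<otimes> b\<close> and \<open>c \<otimes> d\<close>. It is linear in
  each of the four arguments, so it can be evaluated on any representatives of \<open>\<Delta> x\<close> and \<open>\<Delta> y\<close>.\<close>

definition twisted_coordinates :: "'a \<Rightarrow> 'a \<Rightarrow> 'a \<Rightarrow> 'a \<Rightarrow> 'k" where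
  "twisted_coordinates a b c d = (\<Sum>i | component H b i \<noteq> 0. \<Sum>j | component H c j \<noteq> 0.
     q ^ (i * j) * (coordinate w1 (a * component H c j) * coordinate w2 (component H b i * d)))"

lemma linear_coordinate_mult:
  "Vector_Spaces.linear scale (*) (\<lambda>x. coordinate w (x * y))"
  "Vector_Spaces.linear scale (*) (\<lambda>y. coordinate w (x * y))"
  by (rule linear_comp[OF linear_mult(1) linear_coordinate] linear_comp[OF linear_mult(2) linear_coordinate])+

lemma bilinear_twisted_right: "bilinear_map scale (*) (twisted_coordinates a b)"
  unfolding bilinear_map_def
proof (intro conjI allI)
  fix c d
  have "twisted_coordinates a b = (\<lambda>c d. \<Sum>j | component H c j \<noteq> 0. \<Sum>i | component H b i \<noteq> 0.
      q ^ (i * j) * (coordinate w1 (a * component H c j) * coordinate w2 (component H b i * d)))"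
    unfolding twisted_coordinates_def by (intro ext sum.swap)
  then show "Vector_Spaces.linear scale (*) (\<lambda>c. twisted_coordinates a b c d)"
    by (simp only:) (intro linear_sum_components linear_functional_sum linear_functional_mult
      linear_coordinate_mult)
  show "Vector_Spaces.linear scale (*) (twisted_coordinates a b c)"
    unfolding twisted_coordinates_def
    by (intro linear_functional_sum linear_functional_mult linear_coordinate_mult)
qed

lemma bilinear_twisted_left: "bilinear_map scale (*) (\<lambda>a b. twisted_coordinates a b c d)"
  unfolding bilinear_map_def twisted_coordinates_def
  by (intro conjI allI linear_sum_components linear_functional_sum linear_functional_mult
    linear_coordinate_mult)

lemma contract_twisted_mult:
  assumes "Poly_Mapping.keys p \<subseteq> {w. length w = 2}" "Poly_Mapping.keys p' \<subseteq> {w. length w = 2}"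
  shows "contract (*) (\<lambda>x y. coordinate w1 x * coordinate w2 y) (twisted_mult q H p p') =
    contract (*) (\<lambda>a b. contract (*) (twisted_coordinates a b) p') p"
proof -
  note lin = linear_contract[OF field.vector_space_axioms, of "\<lambda>x y. coordinate w1 x * coordinate w2 y"]
  have "contract (*) (\<lambda>x y. coordinate w1 x * coordinate w2 y) (twisted_mult q H p p') =
    lin_extend (*) (\<lambda>u. lin_extend (*) (\<lambda>w. twisted_coordinates (u ! 0) (u ! 1) (w ! 0) (w ! 1)) p') p"
    unfolding twisted_mult_def formal.linear_composed_lin_extend[OF lin] linear_sum[OF lin]
      contract_pair[OF field.vector_space_axioms] twisted_coordinates_def ..
  then show ?thesis
    by (simp add: contract_pairs assms)
qed

end

lemma component_bas:
  "w \<in> lists B \<Longrightarrow> component H (bas w) n = (if n = word_degree w then bas w else 0)"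
  by (rule component_homogeneous[OF bas_degree])

lemma twisted_coordinates_bas:
  assumes "u \<in> lists B" "v \<in> lists B"
  shows "twisted_coordinates w1 w2 a (bas u) (bas v) d =
    q ^ (word_degree u * word_degree v) * (coordinate w1 (a * bas v) * coordinate w2 (bas u * d))"
proof -
  have "{i. component H (bas w) i \<noteq> 0} = {word_degree w}" if "w \<in> lists B" for w
    using that bas_ne_0[OF that] by (auto simp only: component_bas split: if_splits)
  then show ?thesis
    using assms by (simp only: twisted_coordinates_def component_bas) simp
qed

lemma take_drop_lists: "u \<in> lists B \<Longrightarrow> take i u \<in> lists B" "u \<in> lists B \<Longrightarrow> drop i u \<in> lists B"
  by (auto dest: in_set_takeD in_set_dropD)

text \<open>The compatibility of product and coproduct in coordinates. All later information on the product
  comes from this formula and the unit.\<close>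

lemma mult_coefficient_append:
  assumes "u \<in> lists B" "v \<in> lists B" "w1 \<in> lists B" "w2 \<in> lists B"
  shows "mult_coefficient u v (w1 @ w2) = (\<Sum>i\<le>length u. \<Sum>k\<le>length v.
    q ^ (word_degree (drop i u) * word_degree (take k v)) *
    (mult_coefficient (take i u) (take k v) w1 * mult_coefficient (drop i u) (drop k v) w2))"
proof -
  let ?\<Phi> = "contract (*) (\<lambda>x y. coordinate w1 x * coordinate w2 y)"
  let ?T = "twisted_coordinates w1 w2"
  have *: "bilinear_map scale (*) (\<lambda>a b. \<Sum>k\<le>length v. ?T a b (bas (take k v)) (bas (drop k v)))"
    using bilinear_twisted_left unfolding bilinear_map_def by (intro conjI allI linear_functional_sum) blast+
  have "mult_coefficient u v (w1 @ w2) = ?\<Phi> (\<Delta> (bas u * bas v))"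
    unfolding mult_coefficient_def by (rule coordinate_append[OF assms(3,4)])
  also have "\<dots> = ?\<Phi> (twisted_mult q H (\<Delta> (bas u)) (\<Delta> (bas v)))"
    by (rule contract_tensor_eq[OF bilinear_coordinates comult_mult])
  also have "\<dots> = contract (*) (\<lambda>a b. contract (*) (?T a b) (\<Delta> (bas v))) (\<Delta> (bas u))"
    by (rule contract_twisted_mult[OF comult_keys comult_keys])
  also have "\<dots> = (\<Sum>i\<le>length u. \<Sum>k\<le>length v.
      ?T (bas (take i u)) (bas (drop i u)) (bas (take k v)) (bas (drop k v)))"
    by (simp only: contract_comult_bas[OF bilinear_twisted_right] contract_comult_bas[OF *])
  finally show ?thesis
    using assms by (simp only: twisted_coordinates_bas take_drop_lists mult_coefficient_def)
qed

lemma mult_coefficient_Nil: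
  "u \<in> lists B \<Longrightarrow> w \<in> lists B \<Longrightarrow> mult_coefficient u [] w = of_bool (w = u)"
  "u \<in> lists B \<Longrightarrow> w \<in> lists B \<Longrightarrow> mult_coefficient [] u w = of_bool (w = u)"
  by (simp_all only: mult_coefficient_def one_bas[symmetric] mult_1_left mult_1_right coordinate_bas)

text \<open>The first letter \<open>a\<close> of the result must come from a nonempty part of \<open>u\<close> and \<open>v\<close>, because the
  product of two empty words is the unit. What is left of \<open>u\<close> and \<open>v\<close> is then too short for \<open>w\<close>.\<close>

lemma mult_coefficient_long:
  assumes "u \<in> lists B" "v \<in> lists B" "w \<in> lists B" "length u + length v < length w"
  shows "mult_coefficient u v w = 0"
  using assms
proof (induction w arbitrary: u v)
  case (Cons a w)
  have zero: "mult_coefficient (take i u) (take k v) [a] * mult_coefficient (drop i u) (drop k v) w = 0"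
    if "i \<le> length u" "k \<le> length v" for i k
  proof (cases "i = 0 \<and> k = 0")
    case True
    then show ?thesis
      using Cons.prems mult_coefficient_Nil(1)[of "[]" "[a]"] by simp
  next
    case False
    then have "length (drop i u) + length (drop k v) < length w"
      using that Cons.prems by auto
    then have "mult_coefficient (drop i u) (drop k v) w = 0"
      using Cons.prems by (intro Cons.IH take_drop_lists) auto
    then show ?thesis
      by simp
  qed
  have "mult_coefficient u v ([a] @ w) = 0"
    using Cons.prems by (subst mult_coefficient_append)
      (simp, simp, simp, simp, intro sum.neutral ballI, simp only: atMost_iff zero mult_zero_right)
  then show ?case
    by simp
qed simp

text \<open>In the top length the first letter \<open>a\<close> must use up exactly one letter of \<open>u\<close> or of \<open>v\<close>. If it
  is a letter of \<open>v\<close>, it has passed over all of \<open>u\<close>, which gives the power of \<open>q\<close>.\<close>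

lemma mult_coefficient_shuffle:
  assumes "u \<in> lists B" "v \<in> lists B" "a \<in> B" "w \<in> lists B" "length u + length v = Suc (length w)"
  shows "mult_coefficient u v (a # w) =
    (if u \<noteq> [] \<and> hd u = a then mult_coefficient (tl u) v w else 0) +
    (if v \<noteq> [] \<and> hd v = a then q ^ (word_degree u * deg a) * mult_coefficient u (tl v) w else 0)"
proof -
  let ?f = "\<lambda>(i, k). q ^ (word_degree (drop i u) * word_degree (take k v)) *
    (mult_coefficient (take i u) (take k v) [a] * mult_coefficient (drop i u) (drop k v) w)"
  \<comment> \<open>The pair \<open>(i, k)\<close> says that \<open>a\<close> arises from \<open>i\<close> letters of \<open>u\<close> and \<open>k\<close> letters of \<open>v\<close>.\<close>
  let ?A = "(if u = [] then {} else {(1, 0)}) \<union> (if v = [] then {} else {(0, 1)}) :: (nat \<times> nat) set"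
  have "?f x = 0" if x: "x \<in> {..length u} \<times> {..length v} - ?A" for x
  proof -
    obtain i k where ik: "x = (i, k)" "i \<le> length u" "k \<le> length v"
      using x by auto
    consider "i = 0" "k = 0" | "i + k \<ge> 2"
      using x ik by (cases i; cases k) (auto split: if_splits)
    then show ?thesis
    proof cases
      case 1
      then show ?thesis
        using ik assms mult_coefficient_Nil(1)[of "[]" "[a]"] by simp
    next
      case 2
      then show ?thesis
        using ik assms mult_coefficient_long[OF take_drop_lists(2) take_drop_lists(2), of u v w i k] by simp
    qed
  qed
  then have "mult_coefficient u v (a # w) = (\<Sum>x\<in>?A. ?f x)"
    using mult_coefficient_append[of u v "[a]" w] assms
    by (subst sum.mono_neutral_left[of "{..length u} \<times> {..length v}" ?A ?f])
      (auto simp: sum.cartesian_product Suc_le_eq split: if_splits)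
  also have "\<dots> = (if u = [] then 0 else ?f (1, 0)) + (if v = [] then 0 else ?f (0, 1))"
    by simp
  also have "(if u = [] then 0 else ?f (1, 0)) =
      (if u \<noteq> [] \<and> hd u = a then mult_coefficient (tl u) v w else 0)"
    using assms mult_coefficient_Nil(1)[of "[hd u]" "[a]"] by (cases u) auto
  also have "(if v = [] then 0 else ?f (0, 1)) =
      (if v \<noteq> [] \<and> hd v = a then q ^ (word_degree u * deg a) * mult_coefficient u (tl v) w else 0)"
    using assms mult_coefficient_Nil(2)[of "[hd v]" "[a]"] by (cases v) auto
  finally show ?thesis .
qed

text \<open>The convolution of the candidate antipode with the identity, in the top length. The letter
  \<open>w ! i\<close> can come first in the shuffle of \<open>rev (take i w)\<close> and \<open>drop i w\<close>, and also in that of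
  \<open>rev (take (Suc i) w)\<close> and \<open>drop (Suc i) w\<close>. The two contributions cancel, since the braiding
  exponent of the first one is the increase of \<open>inversion_degree\<close>.\<close>

lemma alternating_shuffle_sum:
  assumes "w \<in> lists B" "y \<in> lists B" "length y = length w" "w \<noteq> []"
  shows "(\<Sum>i\<le>length w. (-1) ^ i * q ^ inversion_degree (take i w) *
    mult_coefficient (rev (take i w)) (drop i w) y) = 0"
proof -
  obtain a y' where y: "y = a # y'"
    using assms by (cases y) auto
  \<comment> \<open>The contribution of \<open>w ! i\<close> as the first letter of \<open>drop i w\<close>.\<close>
  define g where "g i = (if i < length w \<and> w ! i = a then (-1) ^ i * q ^ inversion_degree (take (Suc i) w)
    * mult_coefficient (rev (take i w)) (drop (Suc i) w) y' else 0)" for i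
  have "(-1) ^ i * q ^ inversion_degree (take i w) * mult_coefficient (rev (take i w)) (drop i w) y
      = g i - (if i = 0 then 0 else g (i - 1))" if i: "i \<le> length w" for i
  proof -
    have lists: "rev (take i w) \<in> lists B" "drop i w \<in> lists B" "a \<in> B" "y' \<in> lists B"
      using assms take_drop_lists[of w i] by (auto simp: y)
    have first: "(if rev (take i w) \<noteq> [] \<and> hd (rev (take i w)) = a
        then mult_coefficient (tl (rev (take i w))) (drop i w) y' else 0)
      = (if i \<noteq> 0 \<and> w ! (i - 1) = a then mult_coefficient (rev (take (i - 1) w)) (drop i w) y' else 0)"
    proof (cases i)
      case (Suc j)
      then have "take i w = take j w @ [w ! j]"
        using i by (simp add: take_Suc_conv_app_nth)
      then show ?thesis
        using Suc i by simp
    qed simp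
    have second: "(if drop i w \<noteq> [] \<and> hd (drop i w) = a then
        q ^ (word_degree (rev (take i w)) * deg a) * mult_coefficient (rev (take i w)) (tl (drop i w)) y' else 0)
      = (if i < length w \<and> w ! i = a then
        q ^ (word_degree (take i w) * deg a) * mult_coefficient (rev (take i w)) (drop (Suc i) w) y' else 0)"
      using i by (auto simp: hd_drop_conv_nth tl_drop drop_Suc)
    have "(-1) ^ i * q ^ inversion_degree (take i w) * (if i < length w \<and> w ! i = a then
        q ^ (word_degree (take i w) * deg a) * mult_coefficient (rev (take i w)) (drop (Suc i) w) y' else 0) = g i"
      by (simp add: g_def take_Suc_conv_app_nth inversion_degree_snoc power_add)
    moreover have "(-1) ^ i * q ^ inversion_degree (take i w) * (if i \<noteq> 0 \<and> w ! (i - 1) = a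
        then mult_coefficient (rev (take (i - 1) w)) (drop i w) y' else 0) = - (if i = 0 then 0 else g (i - 1))"
      using i by (cases i) (simp_all add: g_def)
    moreover have "length (rev (take i w)) + length (drop i w) = Suc (length y')"
      using assms i by (simp add: y)
    ultimately show ?thesis
      unfolding y by (subst mult_coefficient_shuffle[OF lists]) (simp_all only: first second distrib_left, simp)
  qed
  then have "(\<Sum>i\<le>length w. (-1) ^ i * q ^ inversion_degree (take i w) *
      mult_coefficient (rev (take i w)) (drop i w) y)
      = (\<Sum>i\<le>length w. g i - (if i = 0 then 0 else g (i - 1)))"
    by simp
  also have "\<dots> = g (length w)"
  proof -
    have "(\<Sum>i\<le>n. g i - (if i = 0 then 0 else g (i - 1))) = g n" for n
      by (induction n) simp_all
    then show ?thesis .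
  qed
  finally show ?thesis
    by (simp add: g_def)
qed

end

section \<open>The antipode up to shorter words\<close>

context cofree_q_hopf_algebra
begin

lemma antipode_convolution:
  "(\<Sum>i\<le>length w. S (bas (take i w)) * bas (drop i w)) = (if w = [] then 1 else 0)"
proof -
  have "bilinear_map scale scale (\<lambda>x y. S x * y)"
    using linear_comp[OF antipode_linear linear_mult(1)] linear_mult(2) by (simp add: bilinear_map_def)
  from contract_comult_bas[OF this]
  have "(\<Sum>i\<le>length w. S (bas (take i w)) * bas (drop i w)) = contract scale (\<lambda>x y. S x * y) (\<Delta> (bas w))"
    by simp
  also have "\<dots> = convolution scale \<Delta> S id (bas w)"
    by (simp add: contract_pairs[OF comult_keys] convolution_def)
  also have "\<dots> = (if w = [] then 1 else 0)"
    by (simp add: antipode_left \<Psi>_counit lookup_single when_def)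
  finally show ?thesis .
qed

text \<open>The convolution equation expresses \<open>S w\<close> by the antipodes of the proper prefixes of \<open>w\<close>. In a
  coefficient of length at least that of \<open>w\<close>, the terms of \<open>S (take i w)\<close> shorter than \<open>i\<close> have no share,
  because their products with \<open>drop i w\<close> are too short; the other terms are known by induction. The
  resulting sum is that of the q-shuffle algebra, or zero if the coefficient is longer than \<open>w\<close>.\<close>

lemma antipode_coefficient:
  assumes "w \<in> lists B" "y \<in> lists B" "length w \<le> length y"
  shows "coordinate y (S (bas w)) = (if y = rev w then (-1) ^ length w * q ^ inversion_degree w else 0)"
  using assms
proof (induction "length w" arbitrary: w y rule: less_induct)
  case less
  show ?case
  proof (cases "w = []")
    case True
    have "S (bas []) = bas []"
      using antipode_convolution[of "[]"] by (simp add: one_bas[symmetric])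
    then show ?thesis
      using True less.prems by (simp add: coordinate_bas)
  next
    case False
    let ?t = "\<lambda>i. (-1) ^ i * q ^ inversion_degree (take i w) * mult_coefficient (rev (take i w)) (drop i w) y"
    have prefix: "coordinate y (S (bas (take i w)) * bas (drop i w)) = ?t i" if i: "i < length w" for i
    proof -
      let ?u = "take i w" and ?v = "drop i w"
      let ?A = "words (word_degree ?u)"
      have lists: "?u \<in> lists B" "?v \<in> lists B" "rev ?u \<in> ?A"
        using take_drop_lists[of w i] less.prems by (auto simp: words_def dest: in_set_takeD)
      have "coordinate y (S (bas ?u) * bas ?v)
          = coordinate y ((\<Sum>u'\<in>?A. scale (coordinate u' (S (bas ?u))) (bas u')) * bas ?v)"
        using homogeneous_expansion[OF antipode_degree[OF bas_degree[OF lists(1)]]] by simp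
      also have "\<dots> = (\<Sum>u'\<in>?A. coordinate u' (S (bas ?u)) * mult_coefficient u' ?v y)"
        by (simp add: mult_coefficient_def sum_distrib_right scale_mult_left
          linear_sum[OF linear_coordinate] linear_scaleD[OF linear_coordinate])
      also have "\<dots> = (\<Sum>u'\<in>?A. if u' = rev ?u then ?t i else 0)"
      proof (rule sum.cong[OF refl])
        fix u' assume u': "u' \<in> ?A"
        show "coordinate u' (S (bas ?u)) * mult_coefficient u' ?v y = (if u' = rev ?u then ?t i else 0)"
        proof (cases "length u' < i")
          case True
          then have "mult_coefficient u' ?v y = 0"
            using u' less.prems lists i by (intro mult_coefficient_long) (auto simp: words_def)
          then show ?thesis
            using True i by auto
        next
          case False
          then show ?thesis
            using less.hyps[of ?u u'] i lists(1) u' by (auto simp: words_def)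
        qed
      qed
      also have "\<dots> = ?t i"
        using lists(3) finite_words by simp
      finally show ?thesis .
    qed
    have "(\<Sum>i\<le>length w. coordinate y (S (bas (take i w)) * bas (drop i w))) = 0"
      using antipode_convolution[of w] False
      by (simp add: linear_sum[OF linear_coordinate, symmetric] linear_zero[OF linear_coordinate])
    then have sum: "(\<Sum>i<length w. ?t i) + coordinate y (S (bas w)) = 0"
      using prefix by (simp add: lessThan_Suc_atMost[symmetric] one_bas[symmetric])
    show ?thesis
    proof (cases "length y = length w")
      case True
      then have "(\<Sum>i<length w. ?t i) + ?t (length w) = 0"
        using alternating_shuffle_sum[OF less.prems(1,2) True False]
        by (simp add: lessThan_Suc_atMost[symmetric])
      then have "coordinate y (S (bas w)) = ?t (length w)"
        by (intro add_left_imp_eq[OF trans[OF sum sym]])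
      then show ?thesis
        using less.prems mult_coefficient_Nil(1)[of "rev w" y] by (auto simp: in_lists_conv_set)
    next
      case False
      then have "?t i = 0" if "i < length w" for i
        using that less.prems mult_coefficient_long[of "rev (take i w)" "drop i w" y] take_drop_lists[of w i]
        by (simp add: in_lists_conv_set)
      then have "(\<Sum>i<length w. ?t i) = 0"
        by (intro sum.neutral) blast
      then show ?thesis
        using sum False by auto
    qed
  qed
qed

lemma trace_antipode:
  "trace_on scale (H m) S = (\<Sum>w\<in>palindromes m. (-1) ^ length w * q ^ inversion_degree w)"
proof -
  have "trace_on scale (H m) S = (\<Sum>w\<in>words m. coordinate w (S (bas w)))"
    by (rule trace_on_coordinates[OF subspace_degree finite_words linear_coordinate _
      homogeneous_expansion antipode_linear antipode_degree])
      (auto simp: words_def simp del: in_lists_conv_set intro: bas_degree)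
  also have "\<dots> = (\<Sum>w\<in>words m. if rev w = w then (-1) ^ length w * q ^ inversion_degree w else 0)"
  proof (rule sum.cong[OF refl])
    fix w assume "w \<in> words m"
    then have "w \<in> lists B"
      using words_in_lists by blast
    from antipode_coefficient[OF this this]
    show "coordinate w (S (bas w)) = (if rev w = w then (-1) ^ length w * q ^ inversion_degree w else 0)"
      by auto
  qed
  also have "\<dots> = (\<Sum>w\<in>palindromes m. (-1) ^ length w * q ^ inversion_degree w)"
    by (simp add: palindromes_def sum.inter_filter finite_words)
  finally show ?thesis .
qed

end

section \<open>The trace series\<close>

context cofree_q_hopf_algebra
begin

theorem antipode_trace_series:
  assumes "q \<noteq> 0" and v: "\<And>n. v n = dim (primitives scale \<Delta> \<inter> H n)"
  shows "Abs_fps (\<lambda>m. trace_on scale (H m) S / q ^ (m choose 2)) =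
    (1 - dim_series v q) / (1 - (dim_series v (q ^ 2) oo fps_X ^ 2))"
proof -
  let ?g = "\<lambda>b. 1 / q ^ (deg b choose 2)"
  let ?F = "Abs_fps (\<lambda>m. trace_on scale (H m) S / q ^ (m choose 2))"
  let ?D = "dim_series v (q ^ 2) oo fps_X ^ 2"
  have trace: "?F $ m = (\<Sum>w\<in>palindromes m. (-1) ^ length w * (\<Prod>b\<leftarrow>w. ?g b))" for m
  proof -
    have "((-1) ^ length w * q ^ inversion_degree w) / q ^ (m choose 2) = (-1) ^ length w * (\<Prod>b\<leftarrow>w. ?g b)"
      if "w \<in> palindromes m" for w
      using word_degree_choose_2[OF assms(1), of w] that
      by (simp add: palindromes_def words_def times_divide_eq_right[symmetric] del: times_divide_eq_right)
    then show ?thesis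
      by (simp add: trace_antipode sum_divide_distrib)
  qed
  have no_letters: "{b \<in> B. deg b = 0} = {}"
    using letters_positive by fastforce
  have series: "dim_series v q $ m = (\<Sum>b | b \<in> B \<and> deg b = m. ?g b)" for m
    by (cases "m = 0") (simp_all add: dim_series_def v dim_primitives no_letters del: Collect_empty_eq)
  have double_series: "?D $ i = (\<Sum>b | b \<in> B \<and> 2 * deg b = i. (?g b)\<^sup>2)" for i
  proof (cases "even i")
    case True
    then obtain n where "i = 2 * n"
      by blast
    then show ?thesis
      by (cases "n = 0") (simp_all add: fps_nth_compose_X_power dim_series_def v dim_primitives
        no_letters power_mult[symmetric] power_divide mult.commute del: Collect_empty_eq)
  next
    case False
    then have none: "{b \<in> B. 2 * deg b = i} = {}"
      by auto
    show ?thesis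
      using False by (simp add: fps_nth_compose_X_power none del: Collect_empty_eq)
  qed
  have "?F = 1 - dim_series v q + ?D * ?F"
  proof (rule fps_ext)
    fix m
    show "?F $ m = (1 - dim_series v q + ?D * ?F) $ m"
      using sum_palindromes[OF finite_words letters_positive, of ?g m]
      unfolding trace[symmetric] double_series[symmetric] series[symmetric]
      by (simp add: fps_mult_nth atLeast0AtMost)
  qed
  then have "?F * (1 - ?D) = 1 - dim_series v q"
    by (simp add: algebra_simps)
  moreover have "(1 - ?D) $ 0 = 1"
    by (simp add: dim_series_def)
  then have "1 - ?D \<noteq> 0"
    by (metis fps_zero_nth zero_neq_one)
  ultimately show ?thesis
    by (metis nonzero_mult_div_cancel_right)
qed

end

theorem corollary37:
  fixes q :: "'k::field_char_0"
    and scale :: "'k \<Rightarrow> 'a::ring_1 \<Rightarrow> 'a"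
    and H :: "nat \<Rightarrow> 'a set"
    and \<Delta> :: "'a \<Rightarrow> ('a list \<Rightarrow>\<^sub>0 'k)"
    and \<epsilon> :: "'a \<Rightarrow> 'k"
    and S :: "'a \<Rightarrow> 'a"
    and scaleW :: "'k \<Rightarrow> 'w::ab_group_add \<Rightarrow> 'w"
    and W :: "nat \<Rightarrow> 'w set"
    and v :: "nat \<Rightarrow> nat"
  assumes "q \<noteq> 0"
    and "q_hopf_algebra scale H \<Delta> \<epsilon> q S"
    and "vector_space.dim scale (H 0) = 1"
    and "\<And>m. finite_dimensional scale (H m)"
    and "cofree_on scaleW W scale H \<Delta> \<epsilon>"
    and "\<And>n. v n = vector_space.dim scale (primitives scale \<Delta> \<inter> H n)"
  shows "Abs_fps (\<lambda>m. trace_on scale (H m) S / q ^ (m choose 2)) =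
         (1 - dim_series v q) / (1 - (dim_series v (q ^ 2) oo fps_X ^ 2))"
proof -
  interpret W: graded_vector_space scaleW W
    using assms(5) by (simp add: cofree_on_def)
  obtain \<Psi> where \<Psi>: "deconcatenation_isomorphism scaleW W scale H \<Delta> \<epsilon> \<Psi>"
    using assms(5) by (auto simp: cofree_on_def)
  obtain B where B: "W.independent B" "W.span B = UNIV" "B \<subseteq> (\<Union>m. W m)"
    using W.homogeneous_basis by blast
  obtain deg where deg: "\<And>b. b \<in> B \<Longrightarrow> b \<in> W (deg b)"
    using B(3) by (metis UN_E subsetD)
  interpret cofree_q_hopf_algebra scale H \<Delta> \<epsilon> q S scaleW W B deg \<Psi>
    using assms(2-4) \<Psi> B(1,2) deg
    by (auto intro!: cofree_q_hopf_algebra.intro cofree_q_hopf_algebra_axioms.intro W.graded_vector_space_axioms)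
  show ?thesis
    by (rule antipode_trace_series[OF assms(1,6)])
qed

end
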